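(* Let $\omega$ be an open strict interval of $\mathbb T$, let $T>0$, and let $f_0 \in \mathcal{NC}_{H^2}(\omega,T)$. Then there exists $g\in L^2(\mathbb T)$ such that (1) $\operatorname{supp} g\subset \overline\omega$; (2) $\sum_{n<0} |n|\, |\widehat g(n)|^2 < +\infty$; (3) $f_0 = P_+ g$.
   Context: $\mathbb T$ is the complex unit circle, identified with $\mathbb R/2\pi\mathbb Z$ via $x\mapsto e^{ix}$. An open strict interval of $\mathbb T$ is an open arc $\{e^{ix}:a<x<b\}$ with $0<b-a<2\pi$; $\overline\omega$ is its topological closure. Functions are complex valued; $f\in L^2(\mathbb T)$ is written $f(e^{ix})=\sum_{n\in\mathbb Z}\widehat f(n)e^{inx}$. The Riesz projector is $P_+f(e^{ix})=\sum_{n\ge 0}\widehat f(n)e^{inx}$, and $H^2=P_+L^2(\mathbb T)$. Let $S(t)f(e^{ix})=\sum_{n}\widehat f(n)e^{-|n|t}e^{inx}$ (the semigroup generated by $-|D|$, $|D|f=\sum_n|n|\widehat f(n)e^{inx}$). The $H^2$ control system is $(\partial_t+|D|)f(t,e^{ix})=P_+\mathbf 1_\omega u(t,e^{ix})$, $f(0,\cdot)=f_0\in H^2$, with control $u\in L^2([0,T]\times\omega)$; its solution satisfies $f(T,\cdot)=S(T)f_0+\int_0^TS(T-s)P_+(\mathbf 1_\omega u(s,\cdot))\,ds$, where $\mathbf 1_\omega u$ denotes the extension of $u$ by $0$ outside $\omega$. $\mathcal{NC}_{H^2}(\omega,T)$ is the set of $f_0\in H^2$ for which there is $u\in L^2([0,T]\times\omega)$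 with $f(T,\cdot)=0$. (This set does not depend on $T>0$.) *)

theory Defs
  imports "HOL-Analysis.Analysis"
begin

definition sq_integrable :: "'a measure \<Rightarrow> ('a \<Rightarrow> complex) \<Rightarrow> bool" where
  "sq_integrable M f \<longleftrightarrow> f \<in> borel_measurable M \<and> integrable M (\<lambda>x. (cmod (f x))\<^sup>2)"

lemma sq_integrable_measurable: "sq_integrable M f \<Longrightarrow> f \<in> borel_measurable M"
  by (simp add: sq_integrable_def)

lemma sq_integrable_zero [simp]: "sq_integrable M (\<lambda>_. 0)"
  by (simp add: sq_integrable_def)

lemma sq_integrable_bound:
  assumes "sq_integrable M g" "f \<in> borel_measurable M" "AE x in M. cmod (f x) \<le> cmod (g x)"
  shows "sq_integrable M f"
  using assms unfolding sq_integrable_def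
  by (auto intro!: Bochner_Integration.integrable_bound[of M "\<lambda>x. (cmod (g x))\<^sup>2"]
           elim!: eventually_mono intro: power_mono)

lemma sq_integrable_add:
  assumes "sq_integrable M f" "sq_integrable M g"
  shows "sq_integrable M (\<lambda>x. f x + g x)"
proof -
  have [measurable]: "f \<in> borel_measurable M" "g \<in> borel_measurable M"
    using assms by (auto simp: sq_integrable_def)
  have "(cmod (a + b))\<^sup>2 \<le> 2 * (cmod a)\<^sup>2 + 2 * (cmod b)\<^sup>2" for a b
  proof -
    have "(cmod (a + b))\<^sup>2 \<le> (cmod a + cmod b)\<^sup>2"
      by (intro power_mono norm_triangle_ineq) auto
    also have "\<dots> \<le> 2 * (cmod a)\<^sup>2 + 2 * (cmod b)\<^sup>2"
      using zero_le_power2[of "cmod a - cmod b"] by (simp add: power2_eq_square algebra_simps)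
    finally show ?thesis .
  qed
  moreover have "integrable M (\<lambda>x. 2 * (cmod (f x))\<^sup>2 + 2 * (cmod (g x))\<^sup>2)"
    using assms by (auto simp: sq_integrable_def)
  ultimately show ?thesis
    unfolding sq_integrable_def
    by (auto intro!: Bochner_Integration.integrable_bound[of M "\<lambda>x. 2 * (cmod (f x))\<^sup>2 + 2 * (cmod (g x))\<^sup>2"])
qed

lemma sq_integrable_scaleR:
  assumes "sq_integrable M f"
  shows "sq_integrable M (\<lambda>x. r *\<^sub>R f x)"
  using assms by (auto simp: sq_integrable_def power_mult_distrib)

lemma sq_integrable_minus:
  assumes "sq_integrable M f"
  shows "sq_integrable M (\<lambda>x. - f x)"
  using assms by (auto simp: sq_integrable_def)

lemma sq_integrable_diff:
  assumes "sq_integrable M f" "sq_integrable M g"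
  shows "sq_integrable M (\<lambda>x. f x - g x)"
  using sq_integrable_add[OF assms(1) sq_integrable_minus[OF assms(2)]] by simp

lemma sq_integrable_inner:
  assumes "sq_integrable M f" "sq_integrable M g"
  shows "integrable M (\<lambda>x. f x \<bullet> g x)"
proof -
  have [measurable]: "f \<in> borel_measurable M" "g \<in> borel_measurable M"
    using assms by (auto simp: sq_integrable_def)
  have "\<bar>a \<bullet> b\<bar> \<le> (cmod a)\<^sup>2 + (cmod b)\<^sup>2" for a b :: complex
  proof -
    have "\<bar>a \<bullet> b\<bar> \<le> cmod a * cmod b" by (rule Cauchy_Schwarz_ineq2)
    also have "2 * (cmod a * cmod b) \<le> (cmod a)\<^sup>2 + (cmod b)\<^sup>2"
      using zero_le_power2[of "cmod a - cmod b"] by (simp add: power2_eq_square algebra_simps)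
    finally show ?thesis using mult_nonneg_nonneg[of "cmod a" "cmod b"] by simp
  qed
  moreover have "integrable M (\<lambda>x. (cmod (f x))\<^sup>2 + (cmod (g x))\<^sup>2)"
    using assms by (auto simp: sq_integrable_def)
  ultimately show ?thesis
    by (auto intro!: Bochner_Integration.integrable_bound[of M "\<lambda>x. (cmod (f x))\<^sup>2 + (cmod (g x))\<^sup>2"])
qed

text \<open>Normalized arc length on the unit circle, as a Borel measure on the complex plane
  that charges only the unit circle.\<close>

definition circle_measure :: "complex measure" where
  "circle_measure = distr (uniform_measure lborel {0..<2 * pi}) borel cis"

lemma sets_circle_measure [measurable_cong, simp]: "sets circle_measure = sets borel"
  and space_circle_measure [simp]: "space circle_measure = UNIV"
  by (simp_all add: circle_measure_def)

lemma cis_borel_measurable [measurable]: "cis \<in> borel_measurable borel"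
  by (intro borel_measurable_continuous_onI continuous_intros)

interpretation circle: finite_measure circle_measure
proof
  have "emeasure circle_measure (space circle_measure) = 1"
    by (simp add: circle_measure_def emeasure_distr)
  then show "emeasure circle_measure (space circle_measure) \<noteq> \<infinity>"
    by simp
qed

lemma sq_integrable_const [simp]: "sq_integrable circle_measure (\<lambda>_. c)"
  by (simp add: sq_integrable_def)

text \<open>\<open>L\<^sup>2\<close> of the circle: square integrable functions modulo almost everywhere equality,
  with its structure of a real inner product space.\<close>

definition circle_L2_rel :: "(complex \<Rightarrow> complex) \<Rightarrow> (complex \<Rightarrow> complex) \<Rightarrow> bool" where
  "circle_L2_rel f g \<longleftrightarrow> sq_integrable circle_measure f \<and> sq_integrable circle_measure g \<and>
     (AE z in circle_measure. f z = g z)"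

lemma circle_L2_rel_refl: "circle_L2_rel f f \<longleftrightarrow> sq_integrable circle_measure f"
  by (simp add: circle_L2_rel_def)

quotient_type circle_L2 = "complex \<Rightarrow> complex" / partial: circle_L2_rel
proof (rule part_equivpI)
  show "\<exists>f. circle_L2_rel f f"
    by (rule exI[of _ "\<lambda>_. 0"]) (simp add: circle_L2_rel_def)
  show "symp circle_L2_rel"
    by (auto simp: symp_def circle_L2_rel_def)
  show "transp circle_L2_rel"
    unfolding transp_def circle_L2_rel_def by (auto elim: eventually_elim2)
qed

instantiation circle_L2 :: real_inner
begin

lift_definition zero_circle_L2 :: circle_L2 is "\<lambda>_. 0"
  by (simp add: circle_L2_rel_def)

lift_definition plus_circle_L2 :: "circle_L2 \<Rightarrow> circle_L2 \<Rightarrow> circle_L2" is "\<lambda>f g z. f z + g z"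
  by (auto simp: circle_L2_rel_def intro: sq_integrable_add)

lift_definition uminus_circle_L2 :: "circle_L2 \<Rightarrow> circle_L2" is "\<lambda>f z. - f z"
  by (auto simp: circle_L2_rel_def intro: sq_integrable_minus)

lift_definition minus_circle_L2 :: "circle_L2 \<Rightarrow> circle_L2 \<Rightarrow> circle_L2" is "\<lambda>f g z. f z - g z"
  by (auto simp: circle_L2_rel_def intro: sq_integrable_diff)

lift_definition scaleR_circle_L2 :: "real \<Rightarrow> circle_L2 \<Rightarrow> circle_L2" is "\<lambda>r f z. r *\<^sub>R f z"
  by (auto simp: circle_L2_rel_def intro!: sq_integrable_scaleR)

text \<open>On complex values, \<^term>\<open>x \<bullet> y\<close> is the real part of \<^term>\<open>x * cnj y\<close>, so the
  associated norm is the usual \<open>L\<^sup>2\<close> norm.\<close>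

lift_definition inner_circle_L2 :: "circle_L2 \<Rightarrow> circle_L2 \<Rightarrow> real"
  is "\<lambda>f g. LINT z|circle_measure. f z \<bullet> g z"
  by (rule integral_cong_AE)
     (auto simp: circle_L2_rel_def elim: eventually_elim2
       intro!: borel_measurable_inner sq_integrable_measurable)

definition norm_circle_L2 :: "circle_L2 \<Rightarrow> real" where
  "norm_circle_L2 f = sqrt (inner f f)"

definition dist_circle_L2 :: "circle_L2 \<Rightarrow> circle_L2 \<Rightarrow> real" where
  "dist_circle_L2 f g = norm (f - g)"

definition sgn_circle_L2 :: "circle_L2 \<Rightarrow> circle_L2" where
  "sgn_circle_L2 f = inverse (norm f) *\<^sub>R f"

definition uniformity_circle_L2 :: "(circle_L2 \<times> circle_L2) filter" where
  "uniformity_circle_L2 = (INF e\<in>{0<..}. principal {(f, g). dist f g < e})"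

definition open_circle_L2 :: "circle_L2 set \<Rightarrow> bool" where
  "open_circle_L2 U \<longleftrightarrow> (\<forall>f\<in>U. \<forall>\<^sub>F (f', g) in uniformity. f' = f \<longrightarrow> g \<in> U)"

instance
proof
  fix f g h :: circle_L2 and r s :: real
  show "f + g + h = f + (g + h)"
    by transfer (auto simp: circle_L2_rel_def add.assoc intro!: sq_integrable_add)
  show "f + g = g + f"
    by transfer (auto simp: circle_L2_rel_def add.commute intro!: sq_integrable_add)
  show "0 + f = f"
    by transfer (auto simp: circle_L2_rel_def)
  show "- f + f = 0"
    by transfer (auto simp: circle_L2_rel_def)
  show "f - g = f + - g"
    by transfer (auto simp: circle_L2_rel_def intro!: sq_integrable_diff)
  show "r *\<^sub>R (f + g) = r *\<^sub>R f + r *\<^sub>R g"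
    by transfer (auto simp: circle_L2_rel_def scaleR_add_right
        intro!: sq_integrable_add sq_integrable_scaleR)
  show "(r + s) *\<^sub>R f = r *\<^sub>R f + s *\<^sub>R f"
    by transfer (auto simp: circle_L2_rel_def scaleR_add_left
        intro!: sq_integrable_add sq_integrable_scaleR)
  show "r *\<^sub>R s *\<^sub>R f = (r * s) *\<^sub>R f"
    by transfer (simp add: circle_L2_rel_def sq_integrable_scaleR mult.assoc del: mult_scaleR_left mult_scaleR_right)
  show "1 *\<^sub>R f = f"
    by transfer (auto simp: circle_L2_rel_def)
  show "inner f g = inner g f"
    by transfer (simp add: inner_commute)
  show "inner (f + g) h = inner f h + inner g h"
    by transfer (simp add: circle_L2_rel_def inner_add_left sq_integrable_inner)
  show "inner (r *\<^sub>R f) g = r * inner f g"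
    by transfer simp
  show "0 \<le> inner f f"
    by transfer (simp add: integral_nonneg)
  show "inner f f = 0 \<longleftrightarrow> f = 0"
  proof (transfer, unfold circle_L2_rel_refl)
    fix f :: "complex \<Rightarrow> complex" assume f: "sq_integrable circle_measure f"
    have "(LINT z|circle_measure. f z \<bullet> f z) = 0 \<longleftrightarrow> (AE z in circle_measure. f z \<bullet> f z = 0)"
      by (rule integral_nonneg_eq_0_iff_AE) (auto intro: sq_integrable_inner f)
    then show "(LINT z|circle_measure. f z \<bullet> f z) = 0 \<longleftrightarrow> circle_L2_rel f (\<lambda>_. 0)"
      using f by (simp add: circle_L2_rel_def)
  qed
qed (simp_all add: norm_circle_L2_def dist_circle_L2_def sgn_circle_L2_def
       uniformity_circle_L2_def open_circle_L2_def)

end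

text \<open>The class of a function; functions that are not square integrable are sent to \<open>0\<close>.\<close>

lift_definition mk_L2 :: "(complex \<Rightarrow> complex) \<Rightarrow> circle_L2"
  is "\<lambda>f. if sq_integrable circle_measure f then f else (\<lambda>_. 0)"
  by (simp add: circle_L2_rel_def)

lemma mk_L2_cases: obtains f where "sq_integrable circle_measure f" "F = mk_L2 f"
proof (atomize_elim, transfer)
  fix F assume "circle_L2_rel F F"
  then show "\<exists>f. sq_integrable circle_measure f \<and>
      circle_L2_rel F (if sq_integrable circle_measure f then f else (\<lambda>_. 0))"
    by (intro exI[of _ F]) (auto simp: circle_L2_rel_def)
qed

lemma mk_L2_add:
  assumes "sq_integrable circle_measure f" "sq_integrable circle_measure g"
  shows "mk_L2 (\<lambda>z. f z + g z) = mk_L2 f + mk_L2 g"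
  using assms by transfer (auto simp: circle_L2_rel_def sq_integrable_add)

lemma mk_L2_diff:
  assumes "sq_integrable circle_measure f" "sq_integrable circle_measure g"
  shows "mk_L2 (\<lambda>z. f z - g z) = mk_L2 f - mk_L2 g"
  using assms by transfer (auto simp: circle_L2_rel_def sq_integrable_diff)

lemma mk_L2_scaleR:
  assumes "sq_integrable circle_measure f"
  shows "mk_L2 (\<lambda>z. r *\<^sub>R f z) = r *\<^sub>R mk_L2 f"
  using assms by transfer (auto simp: circle_L2_rel_def sq_integrable_scaleR)

lemma mk_L2_zero: "mk_L2 (\<lambda>_. 0) = 0"
  by transfer (simp add: circle_L2_rel_def)

lemma norm_mk_L2:
  assumes "sq_integrable circle_measure f"
  shows "norm (mk_L2 f) = sqrt (LINT z|circle_measure. (cmod (f z))\<^sup>2)"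
  using assms unfolding norm_circle_L2_def power2_norm_eq_inner by transfer simp

lemma mk_L2_dominated:
  assumes "\<And>i. f i \<in> borel_measurable circle_measure" "g \<in> borel_measurable circle_measure"
    and w: "sq_integrable circle_measure w"
    and bound: "\<And>i z. cmod (f i z) \<le> cmod (w z)"
    and lim: "\<And>z. (\<lambda>i. f i z) \<longlonglongrightarrow> g z"
  shows "sq_integrable circle_measure g" "(\<lambda>i. mk_L2 (f i)) \<longlonglongrightarrow> mk_L2 g"
proof -
  note [measurable] = assms(1,2) sq_integrable_measurable[OF w]
  have g_bound: "cmod (g z) \<le> cmod (w z)" for z
    by (rule Lim_bounded[OF tendsto_norm[OF lim[of z]], of 0]) (use bound in auto)
  show g: "sq_integrable circle_measure g"
    by (rule sq_integrable_bound[OF w]) (auto simp: g_bound)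
  have f: "sq_integrable circle_measure (f i)" for i
    by (rule sq_integrable_bound[OF w]) (auto simp: bound)
  have "(\<lambda>i. LINT z|circle_measure. (cmod (f i z - g z))\<^sup>2) \<longlonglongrightarrow> (LINT z|circle_measure. 0)"
  proof (rule integral_dominated_convergence[where w="\<lambda>z. 4 * (cmod (w z))\<^sup>2"])
    show "integrable circle_measure (\<lambda>z. 4 * (cmod (w z))\<^sup>2)"
      using w by (simp add: sq_integrable_def)
    show "AE z in circle_measure. (\<lambda>i. (cmod (f i z - g z))\<^sup>2) \<longlonglongrightarrow> 0"
    proof (rule AE_I2)
      fix z
      have "(\<lambda>i. f i z - g z) \<longlonglongrightarrow> 0"
        using tendsto_diff[OF lim[of z] tendsto_const[of "g z"]] by simp
      from tendsto_power[OF tendsto_norm[OF this], of 2]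
      show "(\<lambda>i. (cmod (f i z - g z))\<^sup>2) \<longlonglongrightarrow> 0" by simp
    qed
    fix i
    show "AE z in circle_measure. norm ((cmod (f i z - g z))\<^sup>2) \<le> 4 * (cmod (w z))\<^sup>2"
    proof (rule AE_I2)
      fix z
      have "cmod (f i z - g z) \<le> 2 * cmod (w z)"
        using norm_triangle_ineq4[of "f i z" "g z"] bound[of i z] g_bound[of z] by simp
      from power_mono[OF this, of 2]
      show "norm ((cmod (f i z - g z))\<^sup>2) \<le> 4 * (cmod (w z))\<^sup>2"
        by (simp add: power_mult_distrib)
    qed
  qed auto
  then have "(\<lambda>i. norm (mk_L2 (f i) - mk_L2 g)) \<longlonglongrightarrow> 0"
    using tendsto_real_sqrt[of "\<lambda>i. LINT z|circle_measure. (cmod (f i z - g z))\<^sup>2" 0 sequentially]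
    by (simp add: norm_mk_L2 sq_integrable_diff f g flip: mk_L2_diff)
  then show "(\<lambda>i. mk_L2 (f i)) \<longlonglongrightarrow> mk_L2 g"
    using LIM_zero_cancel tendsto_norm_zero_iff by blast
qed

lemma circle_L2_separable: "\<exists>D :: circle_L2 set. countable D \<and> closure D = UNIV"
proof -
  obtain B :: "complex set set" where B: "countable B" "topological_basis B"
    using ex_countable_basis by auto
  define G where "G = Inter ` {F. finite F \<and> F \<subseteq> B}"
  have G: "countable G" "UNIV \<in> G" "B \<subseteq> G"
    using countable_Collect_finite_subset[OF B(1)]
    by (auto simp: G_def intro: image_eqI[of _ _ "{}"] image_eqI[of b Inter "{b}" for b])
  have G_borel: "G \<subseteq> sets borel"
    using topological_basis_open[OF B(2)] by (auto simp: G_def intro!: borel_open open_Inter)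
  have G_Pow: "G \<subseteq> Pow UNIV" by simp
  have G_Int: "Int_stable G"
    unfolding Int_stable_def G_def
    by clarsimp (metis (mono_tags, lifting) Inter_Un_distrib finite_Un image_eqI le_sup_iff mem_Collect_eq)
  have borel_G: "A \<in> sigma_sets UNIV G \<longleftrightarrow> A \<in> sets borel" for A
  proof
    show "A \<in> sigma_sets UNIV G \<Longrightarrow> A \<in> sets borel"
      using sets.sigma_sets_subset[OF G_borel] by auto
    show "A \<in> sets borel \<Longrightarrow> A \<in> sigma_sets UNIV G"
      using sigma_sets_mono'[OF G(3), of UNIV] by (subst (asm) borel_eq_countable_basis[OF B]) auto
  qed
  define D0 where "D0 = (\<lambda>(A, c). mk_L2 (\<lambda>z. indicator A z *\<^sub>R c)) ` (G \<times> {1, \<i>})"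
  define D where "D = (\<lambda>l. sum_list (map (\<lambda>(q, d). q *\<^sub>R d) l)) ` lists ((\<rat> :: real set) \<times> D0)"
  have D_count: "countable D"
    unfolding D_def D0_def
    by (intro countable_image countable_lists countable_SIGMA countable_rat G) auto
  define V where "V = closure D"
  have D_add: "x + y \<in> D" if "x \<in> D" "y \<in> D" for x y
    using that unfolding D_def by (auto intro!: image_eqI[of _ _ "l @ m" for l m])
  have D_scale: "q *\<^sub>R x \<in> D" if qx: "q \<in> \<rat>" "x \<in> D" for q x
  proof -
    obtain l where l: "l \<in> lists (\<rat> \<times> D0)" "x = sum_list (map (\<lambda>(q, d). q *\<^sub>R d) l)"
      using qx(2) unfolding D_def by blast
    have "q *\<^sub>R sum_list (map (\<lambda>(q, d). q *\<^sub>R d) l) =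
        sum_list (map (\<lambda>(q, d). q *\<^sub>R d) (map (\<lambda>(p, d). (q * p, d)) l))"
      by (induction l) (auto simp: scaleR_add_right)
    moreover have "map (\<lambda>(p, d). (q * p, d)) l \<in> lists (\<rat> \<times> D0)"
      using l(1) qx(1) by (induction l) auto
    ultimately show ?thesis unfolding D_def l by blast
  qed
  have D0_V: "x \<in> V" if "x \<in> D0" for x
  proof -
    have "x \<in> D"
      unfolding D_def using that by (intro image_eqI[of _ _ "[(1, x)]"]) auto
    then show ?thesis using closure_subset by (auto simp: V_def)
  qed
  have V_add: "x + y \<in> V" if xy: "x \<in> V" "y \<in> V" for x y
  proof -
    obtain f g where "\<And>n. f n \<in> D" "f \<longlonglongrightarrow> x" "\<And>n. g n \<in> D" "g \<longlonglongrightarrow> y"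
      using xy unfolding V_def closure_sequential by metis
    then have "(\<lambda>n. f n + g n) \<longlonglongrightarrow> x + y" "\<And>n. f n + g n \<in> D"
      by (auto intro: tendsto_add D_add)
    then show ?thesis unfolding V_def closure_sequential by metis
  qed
  have V_scale: "r *\<^sub>R x \<in> V" if x: "x \<in> V" for r x
  proof -
    obtain f where "\<And>n. f n \<in> D" "f \<longlonglongrightarrow> x"
      using x unfolding V_def closure_sequential by metis
    moreover obtain q where "\<And>n. q n \<in> \<rat>" "q \<longlonglongrightarrow> r"
      using Rats_closure_real unfolding closure_sequential set_eq_iff by (metis UNIV_I)
    ultimately have "(\<lambda>n. q n *\<^sub>R f n) \<longlonglongrightarrow> r *\<^sub>R x" "\<And>n. q n *\<^sub>R f n \<in> D"
      by (auto intro: tendsto_scaleR D_scale)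
    then show ?thesis unfolding V_def closure_sequential by metis
  qed
  have V_diff: "x - y \<in> V" if "x \<in> V" "y \<in> V" for x y
    using V_add[OF that(1) V_scale[OF that(2), of "-1"]] by simp
  have V_zero: "0 \<in> V"
    using V_scale[OF D0_V, of _ 0] G(2) by (auto simp: D0_def)
  have V_lim: "x \<in> V" if "\<And>n. f n \<in> V" "f \<longlonglongrightarrow> x" for f x
    using that unfolding V_def by (metis closed_closure closed_sequentially)
  have sq: "sq_integrable circle_measure (\<lambda>z. indicator A z *\<^sub>R c)" if "A \<in> sets borel" for A c
    by (rule sq_integrable_bound[OF sq_integrable_const[of c]])
       (use that in \<open>auto simp: indicator_def\<close>)
  have V_G: "mk_L2 (\<lambda>z. indicator A z *\<^sub>R c) \<in> V" if "A \<in> G" "c \<in> {1, \<i>}" for A c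
    by (rule D0_V) (use that in \<open>auto simp: D0_def intro!: image_eqI[of _ _ "(A, c)"]\<close>)
  have V_ind: "mk_L2 (\<lambda>z. indicator A z *\<^sub>R c) \<in> V" if c: "c \<in> {1, \<i>}" and A: "A \<in> sets borel" for A c
    using A[folded borel_G]
  proof (induction rule: sigma_sets_induct_disjoint[OF G_Int G_Pow, consumes 1, case_names basic empty compl union])
    case (basic A)
    then show ?case using c by (rule V_G)
  next
    case empty
    then show ?case by (simp add: mk_L2_zero V_zero)
  next
    case (compl A)
    have "mk_L2 (\<lambda>z. indicator UNIV z *\<^sub>R c) - mk_L2 (\<lambda>z. indicator A z *\<^sub>R c) \<in> V"
      using c G(2) by (intro V_diff compl V_G)
    also have "mk_L2 (\<lambda>z. indicator UNIV z *\<^sub>R c) - mk_L2 (\<lambda>z. indicator A z *\<^sub>R c) =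
        mk_L2 (\<lambda>z. indicator UNIV z *\<^sub>R c - indicator A z *\<^sub>R c)"
      using compl(1) by (intro mk_L2_diff[symmetric] sq) (auto simp: borel_G)
    also have "(\<lambda>z. indicator UNIV z *\<^sub>R c - indicator A z *\<^sub>R c) = (\<lambda>z. indicator (UNIV - A) z *\<^sub>R c)"
      by (auto simp: indicator_def)
    finally show ?case .
  next
    case (union A)
    have A [measurable]: "A i \<in> sets borel" for i
      using union(2) borel_G by blast
    have part: "sq_integrable circle_measure (\<lambda>z. indicator (\<Union>i<n. A i) z *\<^sub>R c)" for n
      by (intro sq) measurable
    have "mk_L2 (\<lambda>z. indicator (\<Union>i<n. A i) z *\<^sub>R c) \<in> V" for n
    proof (induction n)
      case (Suc n)
      have "(\<lambda>z. indicator (\<Union>i<Suc n. A i) z *\<^sub>R c) =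
          (\<lambda>z. indicator (\<Union>i<n. A i) z *\<^sub>R c + indicator (A n) z *\<^sub>R c)"
      proof
        fix z
        have "A i \<inter> A n = {}" if "i < n" for i
          using union(1) that by (auto simp: disjoint_family_on_def)
        then have "z \<in> A n \<Longrightarrow> z \<notin> (\<Union>i<n. A i)" by blast
        then show "indicator (\<Union>i<Suc n. A i) z *\<^sub>R c =
            indicator (\<Union>i<n. A i) z *\<^sub>R c + indicator (A n) z *\<^sub>R c"
          by (cases "z \<in> A n"; cases "z \<in> (\<Union>i<n. A i)") (simp_all add: lessThan_Suc)
      qed
      then show ?case
        using V_add[OF Suc union(3)[of n]] by (simp add: mk_L2_add part sq)
    qed (simp add: mk_L2_zero V_zero)
    moreover have "(\<lambda>n. mk_L2 (\<lambda>z. indicator (\<Union>i<n. A i) z *\<^sub>R c)) \<longlonglongrightarrow>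
        mk_L2 (\<lambda>z. indicator (\<Union>i. A i) z *\<^sub>R c)"
    proof (rule mk_L2_dominated[OF _ _ sq_integrable_const[of c]])
      show "(\<lambda>n. indicat_real (\<Union>i<n. A i) z *\<^sub>R c) \<longlonglongrightarrow> indicat_real (\<Union>i. A i) z *\<^sub>R c" for z
        by (intro tendsto_scaleR tendsto_const LIMSEQ_indicator_UN)
      show "cmod (indicat_real (\<Union>i<n. A i) z *\<^sub>R c) \<le> cmod c" for n z
        by (simp add: indicator_def)
    qed measurable
    ultimately show ?case by (rule V_lim)
  qed
  have V_ind_all: "mk_L2 (\<lambda>z. indicator A z *\<^sub>R c) \<in> V" if A: "A \<in> sets borel" for A c
  proof -
    have "(\<lambda>z. indicator A z *\<^sub>R c) =
        (\<lambda>z. Re c *\<^sub>R (indicator A z *\<^sub>R 1) + Im c *\<^sub>R (indicator A z *\<^sub>R \<i>))"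
      by (rule ext) (auto simp: indicator_def complex_eq_iff)
    then show ?thesis
      using V_add[OF V_scale[OF V_ind[OF _ A, of 1], of "Re c"] V_scale[OF V_ind[OF _ A, of \<i>], of "Im c"]]
      by (simp add: mk_L2_add mk_L2_scaleR sq_integrable_scaleR sq A del: scaleR_scaleR)
  qed
  have V_simple: "mk_L2 f \<in> V" if f: "simple_function circle_measure f" for f :: "complex \<Rightarrow> complex"
  proof -
    have "sq_integrable circle_measure (\<lambda>z. \<Sum>y\<in>Y. indicator (f -` {y}) z *\<^sub>R y) \<and>
        mk_L2 (\<lambda>z. \<Sum>y\<in>Y. indicator (f -` {y}) z *\<^sub>R y) \<in> V" if "finite Y" for Y
      using that
    proof (induction Y)
      case (insert y Y)
      have "f -` {y} \<in> sets borel"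
        using simple_functionD(2)[OF f, of "{y}"] by simp
      from sq[OF this, of y] V_ind_all[OF this, of y] insert.IH show ?case
        unfolding sum.insert[OF insert.hyps]
        by (intro conjI sq_integrable_add) (simp_all only: mk_L2_add V_add)
    qed (simp add: mk_L2_zero V_zero)
    note span = this
    have rep: "f = (\<lambda>z. \<Sum>y\<in>range f. indicator (f -` {y}) z *\<^sub>R y)"
      using simple_function_indicator_representation_banach[OF f]
      unfolding space_circle_measure Int_UNIV_right by (intro ext) blast
    have fin: "finite (range f)"
      using simple_functionD(1)[OF f] by simp
    show ?thesis
      by (subst rep) (rule span[OF fin, THEN conjunct2])
  qed
  have "F \<in> V" for F
  proof -
    obtain f where f: "sq_integrable circle_measure f" "F = mk_L2 f"
      by (rule mk_L2_cases)
    obtain s where s: "\<And>i. simple_function circle_measure (s i)"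
        "\<And>z. (\<lambda>i. s i z) \<longlonglongrightarrow> f z" "\<And>i z. dist (s i z) 0 \<le> 2 * dist (f z) 0"
      using borel_measurable_implies_sequence_metric[OF sq_integrable_measurable[OF f(1)], of 0]
      by auto
    have "(\<lambda>i. mk_L2 (s i)) \<longlonglongrightarrow> mk_L2 f"
      by (rule mk_L2_dominated[OF _ _ sq_integrable_scaleR[OF f(1), of 2]])
         (use s in \<open>auto intro: borel_measurable_simple_function sq_integrable_measurable[OF f(1)]\<close>)
    then show ?thesis
      using V_lim V_simple s(1) f(2) by metis
  qed
  then show ?thesis using D_count by (auto simp: V_def)
qed

instance circle_L2 :: second_countable_topology
proof
  obtain D :: "circle_L2 set" where D: "countable D" "closure D = UNIV"
    using circle_L2_separable by auto
  define B where "B = (\<lambda>(x, q). ball x q) ` (D \<times> (\<rat> \<inter> {0<..}))"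
  have "countable B"
    unfolding B_def by (intro countable_image countable_SIGMA D countable_Int1 countable_rat)
  moreover have "topological_basis B"
  proof (rule topological_basisI)
    fix U :: "circle_L2 set" and x assume "open U" "x \<in> U"
    then obtain e where e: "e > 0" "ball x e \<subseteq> U"
      by (auto simp: open_contains_ball)
    obtain q where q: "q \<in> \<rat>" "0 < q" "q < e / 2"
      using Rats_dense_in_real[of 0 "e / 2"] e(1) by auto
    obtain y where y: "y \<in> D" "dist y x < q"
      using D(2) q(2) by (metis UNIV_I closure_approachable)
    have "ball y q \<subseteq> ball x e"
    proof
      fix z assume "z \<in> ball y q"
      then show "z \<in> ball x e"
        using y(2) q(3) dist_triangle[of x z y] by (simp add: dist_commute)
    qed
    then show "\<exists>B'\<in>B. x \<in> B' \<and> B' \<subseteq> U"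
      using y q e by (intro bexI[of _ "ball y q"]) (auto simp: B_def)
  qed (auto simp: B_def)
  ultimately show "\<exists>B :: circle_L2 set set. countable B \<and> open = generate_topology B"
    using topological_basis_imp_subbasis by blast
qed

text \<open>As \<^const>\<open>circle_measure\<close> is normalized, this is
  \<open>1/(2\<pi>) \<integral> f(e\<^sup>i\<^sup>x) e\<^sup>-\<^sup>i\<^sup>n\<^sup>x dx\<close>.\<close>

lift_definition fourier_coeff :: "circle_L2 \<Rightarrow> int \<Rightarrow> complex"
  is "\<lambda>f n. LINT z|circle_measure. f z * z powi (- n)"
proof (rule ext)
  fix f g :: "complex \<Rightarrow> complex" and n
  assume fg: "circle_L2_rel f g"
  have [measurable]: "f \<in> borel_measurable circle_measure" "g \<in> borel_measurable circle_measure"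
    using fg by (auto simp: circle_L2_rel_def sq_integrable_measurable)
  show "(LINT z|circle_measure. f z * z powi (- n)) = (LINT z|circle_measure. g z * z powi (- n))"
    using fg unfolding power_int_def
    by (intro integral_cong_AE) (auto simp: circle_L2_rel_def)
qed

text \<open>The (closed) support of a class: the complement of the largest open set on which it
  vanishes almost everywhere.\<close>

lift_definition L2_support :: "circle_L2 \<Rightarrow> complex set"
  is "\<lambda>f. - \<Union>{U. open U \<and> (AE z in circle_measure. z \<in> U \<longrightarrow> f z = 0)}"
proof -
  fix f g assume fg: "circle_L2_rel f g"
  have "(AE z in circle_measure. z \<in> U \<longrightarrow> f z = 0) \<longleftrightarrow> (AE z in circle_measure. z \<in> U \<longrightarrow> g z = 0)" for U
    using fg by (intro eventually_subst) (auto simp: circle_L2_rel_def elim: eventually_mono)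
  then show "- \<Union>{U. open U \<and> (AE z in circle_measure. z \<in> U \<longrightarrow> f z = 0)} =
      - \<Union>{U. open U \<and> (AE z in circle_measure. z \<in> U \<longrightarrow> g z = 0)}"
    by simp
qed

text \<open>The series below are unconditional sums in the norm of \<^typ>\<open>circle_L2\<close>.\<close>

definition riesz_projector :: "circle_L2 \<Rightarrow> circle_L2" where
  "riesz_projector f = (\<Sum>\<^sub>\<infinity>n\<in>{0..}. mk_L2 (\<lambda>z. fourier_coeff f n * z powi n))"

definition hardy_H2 :: "circle_L2 set" where
  "hardy_H2 = range riesz_projector"

text \<open>The semigroup \<open>S(t)\<close> generated by \<open>-|D|\<close>, meant for \<^prop>\<open>t \<ge> 0\<close>.\<close>

definition semigroup_absD :: "real \<Rightarrow> circle_L2 \<Rightarrow> circle_L2" where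
  "semigroup_absD t f =
     (\<Sum>\<^sub>\<infinity>n\<in>UNIV. mk_L2 (\<lambda>z. fourier_coeff f n * of_real (exp (- (\<bar>real_of_int n\<bar> * t))) * z powi n))"

definition open_strict_interval :: "complex set \<Rightarrow> bool" where
  "open_strict_interval \<omega> \<longleftrightarrow>
     (\<exists>a b :: real. 0 < b - a \<and> b - a < 2 * pi \<and> \<omega> = cis ` {a<..<b})"

definition L2_control :: "complex set \<Rightarrow> real \<Rightarrow> (real \<Rightarrow> complex \<Rightarrow> complex) \<Rightarrow> bool" where
  "L2_control \<omega> T u \<longleftrightarrow>
     sq_integrable (restrict_space (lborel \<Otimes>\<^sub>M circle_measure) ({0..T} \<times> \<omega>)) (\<lambda>(s, z). u s z)"

text \<open>\<open>F\<close> is the final state \<open>f(T, \<cdot>)\<close> of the controlled trajectory: Duhamel's formula with an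
  \<open>L\<^sup>2\<close>-valued Bochner integral (which exists for every \<open>L\<^sup>2\<close> control). For almost every
  \<open>s\<close> the slice \<open>u(s, \<cdot>)\<close> is square integrable on \<open>\<omega>\<close>; on the exceptional null set
  \<^const>\<open>mk_L2\<close> gives \<open>0\<close>.\<close>

definition H2_final_state ::
  "complex set \<Rightarrow> real \<Rightarrow> circle_L2 \<Rightarrow> (real \<Rightarrow> complex \<Rightarrow> complex) \<Rightarrow> circle_L2 \<Rightarrow> bool" where
  "H2_final_state \<omega> T f0 u F \<longleftrightarrow>
     (\<exists>I. has_bochner_integral (restrict_space lborel {0..T})
            (\<lambda>s. semigroup_absD (T - s)
                   (riesz_projector (mk_L2 (\<lambda>z. if z \<in> \<omega> then u s z else 0)))) I \<and>
          F = semigroup_absD T f0 + I)"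

definition null_controllable_H2 :: "complex set \<Rightarrow> real \<Rightarrow> circle_L2 set" where
  "null_controllable_H2 \<omega> T =
     {f0 \<in> hardy_H2. \<exists>u. L2_control \<omega> T u \<and> H2_final_state \<omega> T f0 u 0}"

end

theory Submission
  imports Defs "HOL-Complex_Analysis.Complex_Analysis"
begin

text \<open>
  Put \<open>q(s,z) = e\<^sup>-\<^sup>s z\<close> and let \<open>v\<close> be the control extended by zero to the whole time-space strip. By
  Duhamel's formula, \<open>f(T) = 0\<close> says that the Fourier coefficients of \<open>f0\<close> of index
  \<open>n \<ge> 0\<close> are \<open>a(n) = - \<integral> v q\<^sup>-\<^sup>n\<close>. This formula makes sense for every integer \<open>n\<close>, and \<open>g\<close> is the
  function with coefficients \<open>a(n)\<close>. For \<open>n < 0\<close> the factor \<open>e\<^sup>n\<^sup>s\<close> decays, so Bessel's inequality in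
  each time slice gives the weighted summability. For the support, consider the
  Cauchy transform \<open>C(w) = - \<integral> v q / (q - w)\<close>, which is holomorphic off the compact set
  \<open>K = {e\<^sup>-\<^sup>s z | s \<in> [0,T], z \<in> closure \<omega>}\<close>. Its Taylor coefficients at \<open>0\<close> are \<open>a(n)\<close>,
  \<open>n \<ge> 0\<close>, and its Laurent coefficients at infinity are \<open>- a(n)\<close>, \<open>n < 0\<close>. As the disk minus \<open>K\<close> is
  star-shaped about \<open>0\<close>, the Poisson means of \<open>g\<close> at a point \<open>z\<close> of the circle outside \<open>closure \<omega>\<close> are
  \<open>C(rz) - C(z/r)/r\<close>, up to the harmless choice of the weight \<open>r\<^sup>n\<close> or \<open>r\<^sup>n\<^sup>-\<^sup>1\<close>, and they tend to \<open>0\<close>.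
\<close>

section \<open>Fourier series on the circle\<close>

lemma prob_space_circle: "measure circle_measure UNIV = 1"
  by (simp add: circle_measure_def measure_distr)

lemma AE_circle_norm: "AE z in circle_measure. cmod z = 1"
  unfolding circle_measure_def by (subst AE_distr_iff) auto

lemma borel_measurable_powi [measurable]:
  fixes f :: "'a \<Rightarrow> complex"
  assumes [measurable]: "f \<in> borel_measurable M"
  shows "(\<lambda>x. f x powi n) \<in> borel_measurable M"
  unfolding power_int_def by measurable

lemma circle_integral:
  fixes f :: "complex \<Rightarrow> complex"
  assumes [measurable]: "f \<in> borel_measurable borel"
  shows "(LINT z|circle_measure. f z) = (LINT x:{0..2*pi}|lborel. f (cis x)) /\<^sub>R (2 * pi)"
proof -
  have "(LINT z|circle_measure. f z) = (LINT x|uniform_measure lborel {0..<2*pi}. f (cis x))"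
    unfolding circle_measure_def by (subst integral_distr) auto
  also have "uniform_measure lborel {0..<2*pi} =
      density lborel (\<lambda>x. ennreal (indicator {0..<2*pi} x / (2 * pi)))"
  proof -
    have "indicator {0..<2*pi} x / emeasure lborel {0..<2*pi} =
        ennreal (indicator {0..<2*pi} x / (2 * pi))" for x :: real
      by (subst divide_ennreal[symmetric]) (auto simp: ennreal_indicator)
    then show ?thesis
      by (simp only: uniform_measure_def)
  qed
  also have "(LINT x|density lborel (\<lambda>x. ennreal (indicator {0..<2*pi} x / (2 * pi))). f (cis x)) =
      (LINT x|lborel. (indicator {0..<2*pi} x / (2 * pi)) *\<^sub>R f (cis x))"
    by (rule integral_density) auto
  \<comment> \<open>The half-open and the closed interval differ by the null point
    \<open>2 * pi\<close>; the closed one suits the fundamental theorem of calculus used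
    next.\<close>
  also have "\<dots> = (LINT x|lborel. (1 / (2 * pi)) *\<^sub>R (indicator {0..2*pi} x *\<^sub>R f (cis x)))"
  proof (rule integral_cong_AE)
    show "AE x in lborel. (indicator {0..<2*pi} x / (2 * pi)) *\<^sub>R f (cis x) =
        (1 / (2 * pi)) *\<^sub>R (indicator {0..2*pi} x *\<^sub>R f (cis x))"
      using AE_lborel_singleton[of "2*pi"] by eventually_elim (auto simp: indicator_def)
  qed measurable
  also have "\<dots> = (LINT x:{0..2*pi}|lborel. f (cis x)) /\<^sub>R (2 * pi)"
    unfolding set_lebesgue_integral_def integral_scaleR_right inverse_eq_divide ..
  finally show ?thesis .
qed

text \<open>Orthogonality of the characters: for \<open>n \<noteq> 0\<close> the antiderivative
  \<open>cis (n * x) / (n * \<i>)\<close> is periodic, so its boundary values cancel.\<close>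

lemma circle_integral_powi:
  "(LINT z|circle_measure. z powi n) = (if n = 0 then 1 else 0)"
proof (cases "n = 0")
  case True
  then show ?thesis by (simp add: prob_space_circle)
next
  case False
  have "(LINT x|lborel. indicator {0..2*pi} x *\<^sub>R cis (of_int n * x)) =
      cis (of_int n * (2*pi)) / (of_int n * \<i>) - cis (of_int n * 0) / (of_int n * \<i>)"
  proof (rule integral_FTC_atLeastAtMost)
    fix x :: real
    have "((\<lambda>x. exp (\<i> * of_int n * x)) has_field_derivative
        \<i> * of_int n * exp (\<i> * of_int n * x)) (at (of_real x))"
      by (auto intro!: derivative_eq_intros)
    from has_vector_derivative_real_field[OF this]
    have "((\<lambda>x. cis (of_int n * x)) has_vector_derivative
        of_int n * \<i> * cis (of_int n * x)) (at x within {0..2 * pi})"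
      by (simp add: cis_conv_exp mult_ac)
    from has_vector_derivative_divide[OF this, of "of_int n * \<i>"]
    show "((\<lambda>x. cis (of_int n * x) / (of_int n * \<i>)) has_vector_derivative
        cis (of_int n * x)) (at x within {0..2 * pi})"
      using False by (simp add: scaleR_conv_of_real)
  qed (auto intro!: continuous_intros)
  also have "\<dots> = 0"
    using cis_multiple_2pi[of "of_int n"] by (simp add: mult_ac)
  finally have "(LINT x:{0..2*pi}|lborel. cis x powi n) = 0"
    by (simp add: set_lebesgue_integral_def cis_power_int)
  then show ?thesis
    using False by (simp add: circle_integral)
qed

lemma sq_integrable_AE_bounded:
  assumes "f \<in> borel_measurable borel" "AE z in circle_measure. cmod (f z) \<le> C"
  shows "sq_integrable circle_measure f"
proof (rule sq_integrable_bound[OF sq_integrable_const[of "of_real C"]])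
  show "AE z in circle_measure. cmod (f z) \<le> cmod (of_real C)"
    using assms(2) by eventually_elim simp
qed (use assms in simp)

lemma mk_L2_cong_AE:
  assumes "f \<in> borel_measurable borel" "g \<in> borel_measurable borel"
    and "AE z in circle_measure. f z = g z"
  shows "mk_L2 f = mk_L2 g"
proof -
  note [measurable] = assms(1,2)
  \<comment> \<open>Since \<open>mk_L2\<close> sends functions that are not square integrable to 0,
    both functions must first be seen to fall under the same case.\<close>
  have "AE z in circle_measure. (cmod (f z))\<^sup>2 = (cmod (g z))\<^sup>2"
    using assms(3) by eventually_elim simp
  then have "integrable circle_measure (\<lambda>z. (cmod (f z))\<^sup>2) \<longleftrightarrow>
      integrable circle_measure (\<lambda>z. (cmod (g z))\<^sup>2)"
    by (intro integrable_cong_AE) measurable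
  then have "sq_integrable circle_measure f \<longleftrightarrow> sq_integrable circle_measure g"
    using assms by (simp add: sq_integrable_def)
  then show ?thesis
    using assms(3) by transfer (auto simp: circle_L2_rel_def)
qed

lemma inner_mk_L2:
  assumes "sq_integrable circle_measure f" "sq_integrable circle_measure g"
  shows "mk_L2 f \<bullet> mk_L2 g = (LINT z|circle_measure. f z \<bullet> g z)"
  using assms by transfer simp

lemma norm_mk_L2_le:
  assumes "f \<in> borel_measurable borel" "AE z in circle_measure. cmod (f z) \<le> C" "0 \<le> C"
  shows "norm (mk_L2 f) \<le> C"
proof -
  have f: "sq_integrable circle_measure f"
    using assms by (intro sq_integrable_AE_bounded)
  have "(LINT z|circle_measure. (cmod (f z))\<^sup>2) \<le> (LINT z|circle_measure. C\<^sup>2)"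
    using f assms by (intro integral_mono_AE)
      (auto simp: sq_integrable_def elim!: eventually_mono intro: power_mono)
  also have "\<dots> = C\<^sup>2"
    by (simp add: prob_space_circle)
  finally show ?thesis
    using assms(3) by (simp add: norm_mk_L2[OF f] real_le_lsqrt)
qed

lemma fourier_coeff_mk_L2:
  assumes "sq_integrable circle_measure f"
  shows "fourier_coeff (mk_L2 f) n = (LINT z|circle_measure. f z * z powi (- n))"
  using assms by transfer simp

text \<open>The common summand of the series that define \<open>riesz_projector\<close> and
  \<open>semigroup_absD\<close>, named so that both can be folded to it.\<close>

definition fourier_term :: "int \<Rightarrow> complex \<Rightarrow> circle_L2" where
  "fourier_term n c = mk_L2 (\<lambda>z. c * z powi n)"

lemma sq_integrable_powi: "sq_integrable circle_measure (\<lambda>z. c * z powi n)"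
  by (rule sq_integrable_AE_bounded[of _ "cmod c"])
     (use AE_circle_norm in \<open>auto simp: norm_mult norm_power_int elim!: eventually_mono\<close>)

lemma sq_integrable_imp_integrable:
  assumes "sq_integrable circle_measure f"
  shows "integrable circle_measure f"
proof (rule Bochner_Integration.integrable_bound[where g = f and f = "\<lambda>z. 1 + (cmod (f z))\<^sup>2"])
  have "cmod w \<le> 1 + (cmod w)\<^sup>2" for w
    using zero_le_power2[of "cmod w - 1"] norm_ge_zero[of w]
    by (simp add: power2_diff del: norm_ge_zero)
  then show "AE z in circle_measure. cmod (f z) \<le> norm (1 + (cmod (f z))\<^sup>2)"
    by (simp add: abs_of_nonneg)
qed (use assms in \<open>auto simp: sq_integrable_def\<close>)

lemma integrable_mult_powi:
  assumes "integrable circle_measure f"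
  shows "integrable circle_measure (\<lambda>z. f z * z powi n)"
proof (rule Bochner_Integration.integrable_bound[OF assms])
  show "AE z in circle_measure. cmod (f z * z powi n) \<le> cmod (f z)"
    using AE_circle_norm by eventually_elim (simp add: norm_mult norm_power_int)
  show "(\<lambda>z. f z * z powi n) \<in> borel_measurable circle_measure"
    using borel_measurable_integrable[OF assms] by measurable
qed

text \<open>On the circle the conjugate of \<open>z powi n\<close> is \<open>z powi (- n)\<close>.
  As the inner product of \<open>circle_L2\<close> is real, only a real part of the coefficient is
  visible here.\<close>

lemma inner_fourier_term: "f \<bullet> fourier_term n c = Re (fourier_coeff f n * cnj c)"
proof -
  obtain F where F: "sq_integrable circle_measure F" "f = mk_L2 F"
    by (rule mk_L2_cases)
  note [measurable] = sq_integrable_measurable[OF F(1)]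
  have inner_eq: "Re (a * cnj w * cnj c) = a \<bullet> (c * w)" for a w
    by (simp add: inner_complex_def algebra_simps)
  have int: "integrable circle_measure (\<lambda>z. F z * z powi (- n) * cnj c)"
    by (intro integrable_mult_left integrable_mult_powi sq_integrable_imp_integrable F)
  have "f \<bullet> fourier_term n c = (LINT z|circle_measure. F z \<bullet> (c * z powi n))"
    using F by (simp add: fourier_term_def inner_mk_L2 sq_integrable_powi)
  also have "\<dots> = (LINT z|circle_measure. Re (F z * z powi (- n) * cnj c))"
  proof (rule integral_cong_AE)
    show "AE z in circle_measure. F z \<bullet> (c * z powi n) = Re (F z * z powi (- n) * cnj c)"
      using AE_circle_norm
    proof eventually_elim
      case (elim z)
      have "z * cnj z = 1"
        using elim complex_norm_square[of z] by simp
      then have "cnj z = inverse z"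
        using inverse_unique by metis
      then have "cnj (z powi n) = z powi (- n)"
        by (simp only: complex_cnj_power_int power_int_minus power_int_inverse)
      then have "Re (F z * z powi (- n) * cnj c) = Re (F z * cnj (z powi n) * cnj c)"
        by simp
      also have "\<dots> = F z \<bullet> (c * z powi n)"
        by (rule inner_eq)
      finally show ?case ..
    qed
  qed measurable
  also have "\<dots> = Re (LINT z|circle_measure. F z * z powi (- n) * cnj c)"
    using int by (rule integral_Re)
  also have "\<dots> = Re (fourier_coeff f n * cnj c)"
    using F by (simp add: fourier_coeff_mk_L2)
  finally show ?thesis .
qed

lemma fourier_coeff_fourier_term: "fourier_coeff (fourier_term m c) n = (if m = n then c else 0)"
proof -
  have "fourier_coeff (fourier_term m c) n = (LINT z|circle_measure. c * z powi m * z powi (- n))"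
    by (simp add: fourier_term_def fourier_coeff_mk_L2 sq_integrable_powi)
  also have "\<dots> = (LINT z|circle_measure. c * z powi (m - n))"
  proof (rule integral_cong_AE)
    show "AE z in circle_measure. c * z powi m * z powi (- n) = c * z powi (m - n)"
      using AE_circle_norm
    proof eventually_elim
      case (elim z)
      then have "z \<noteq> 0" by auto
      then show ?case by (simp add: power_int_diff power_int_minus divide_inverse)
    qed
  qed measurable
  finally show ?thesis
    by (simp add: circle_integral_powi)
qed

text \<open>The choices \<open>c = 1\<close> and \<open>c = \<i>\<close> in
  \<open>inner_fourier_term\<close> give the real and the imaginary part. Bounded linearity of the
  coefficient then comes from that of the inner product.\<close>

lemma fourier_coeff_eq_inner:
  "fourier_coeff f n = of_real (f \<bullet> fourier_term n 1) + \<i> * of_real (f \<bullet> fourier_term n \<i>)"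
  by (simp add: inner_fourier_term complex_eq_iff)

lemma bounded_linear_fourier_coeff: "bounded_linear (\<lambda>f. fourier_coeff f n)"
proof -
  have inner: "bounded_linear (\<lambda>f. complex_of_real (f \<bullet> h))" for h :: circle_L2
    by (rule bounded_linear_compose[OF bounded_linear_of_real bounded_linear_inner_left])
  show ?thesis
    unfolding fourier_coeff_eq_inner
    by (rule bounded_linear_add[OF inner bounded_linear_compose[OF bounded_linear_mult_right inner]])
qed

lemma fourier_term_diff: "fourier_term n (c - d) = fourier_term n c - fourier_term n d"
  unfolding fourier_term_def left_diff_distrib by (rule mk_L2_diff[OF sq_integrable_powi sq_integrable_powi])

lemma Re_mult_cnj: "Re (c * cnj c) = (cmod c)\<^sup>2"
  by (metis Re_complex_of_real complex_norm_square)

text \<open>Parseval for trigonometric polynomials: pairing the sum with its own term of frequency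
  \<open>m\<close> extracts the coefficient \<open>c m\<close>.\<close>

lemma norm_sum_fourier_term:
  assumes "finite F"
  shows "(norm (\<Sum>n\<in>F. fourier_term n (c n)))\<^sup>2 = (\<Sum>n\<in>F. (cmod (c n))\<^sup>2)"
proof -
  have *: "fourier_coeff (\<Sum>n\<in>F. fourier_term n (c n)) m = c m" if "m \<in> F" for m
    using that assms
    by (simp add: linear_sum[OF bounded_linear.linear[OF bounded_linear_fourier_coeff]]
        fourier_coeff_fourier_term)
  have "(norm (\<Sum>n\<in>F. fourier_term n (c n)))\<^sup>2 =
      (\<Sum>m\<in>F. (\<Sum>n\<in>F. fourier_term n (c n)) \<bullet> fourier_term m (c m))"
    by (simp add: power2_norm_eq_inner inner_sum_right)
  also have "\<dots> = (\<Sum>n\<in>F. (cmod (c n))\<^sup>2)"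
    by (intro sum.cong refl) (simp add: inner_fourier_term * Re_mult_cnj del: times_complex.simps)
  finally show ?thesis .
qed

text \<open>With \<open>?p\<close> the partial Fourier sum, \<open>f \<bullet> ?p\<close> equals the
  squared norm of \<open>?p\<close>; expanding the nonnegative squared norm of \<open>f - ?p\<close>
  gives the claim.\<close>

lemma bessel_inequality:
  assumes "finite F"
  shows "(\<Sum>n\<in>F. (cmod (fourier_coeff f n))\<^sup>2) \<le> (norm f)\<^sup>2"
proof -
  let ?p = "\<Sum>n\<in>F. fourier_term n (fourier_coeff f n)"
  have "f \<bullet> ?p = (\<Sum>n\<in>F. (cmod (fourier_coeff f n))\<^sup>2)"
    unfolding inner_sum_right
    by (intro sum.cong refl) (simp add: inner_fourier_term Re_mult_cnj del: times_complex.simps)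
  moreover have "(norm (f - ?p))\<^sup>2 = (norm f)\<^sup>2 - 2 * (f \<bullet> ?p) + (norm ?p)\<^sup>2"
    by (simp add: power2_norm_eq_inner inner_diff inner_commute)
  ultimately show ?thesis
    using norm_sum_fourier_term[OF assms, of "fourier_coeff f"] zero_le_power2[of "norm (f - ?p)"]
    by linarith
qed

lemma bessel_summable: "(\<lambda>n. (cmod (fourier_coeff f n))\<^sup>2) summable_on A"
  by (rule nonneg_bdd_above_summable_on)
     (auto intro!: bdd_aboveI[of _ "(norm f)\<^sup>2"] bessel_inequality)

section \<open>Completeness\<close>

text \<open>The core of the Riesz-Fischer theorem. The sums of the moduli of the increments have
  bounded norms, so by monotone convergence their limit is square integrable and finite almost
  everywhere. It makes the telescoping series converge absolutely and supplies a dominating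
  function.\<close>

lemma convergent_mk_L2_fast:
  assumes f: "\<And>n. sq_integrable circle_measure (f n)"
    and fast: "\<And>n. norm (mk_L2 (f (Suc n)) - mk_L2 (f n)) \<le> (1 / 2) ^ n"
  shows "convergent (\<lambda>n. mk_L2 (f n))"
proof -
  note [measurable] = f[THEN sq_integrable_measurable]
  define D where "D n z = f (Suc n) z - f n z" for n z
  define W where "W N z = (\<Sum>k<N. cmod (D k z))" for N z
  define S where "S z = (SUP N. ennreal ((W N z)\<^sup>2))" for z
  define w where "w z = sqrt (enn2real (S z))" for z
  have [measurable]: "D n \<in> borel_measurable borel" for n
    unfolding D_def by measurable
  have [measurable]: "W n \<in> borel_measurable borel" for n
    unfolding W_def by measurable
  have [measurable]: "S \<in> borel_measurable borel"
    unfolding S_def by measurable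
  have [measurable]: "w \<in> borel_measurable borel"
    unfolding w_def by measurable
  have D: "sq_integrable circle_measure (D n)" for n
    unfolding D_def by (intro sq_integrable_diff f)
  have absD: "sq_integrable circle_measure (\<lambda>z. of_real (cmod (D n z)))" for n
    by (rule sq_integrable_bound[OF D[of n]]) auto
  have W_bound: "sq_integrable circle_measure (\<lambda>z. of_real (W N z)) \<and>
      norm (mk_L2 (\<lambda>z. of_real (W N z))) \<le> (\<Sum>k<N. (1 / 2) ^ k)" for N
  proof (induction N)
    case 0
    then show ?case by (simp add: W_def mk_L2_zero)
  next
    case (Suc N)
    have "norm (mk_L2 (\<lambda>z. of_real (cmod (D N z)))) = norm (mk_L2 (D N))"
      by (simp add: norm_mk_L2 absD D)
    also have "mk_L2 (D N) = mk_L2 (f (Suc N)) - mk_L2 (f N)"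
      unfolding D_def by (intro mk_L2_diff f)
    finally have "norm (mk_L2 (\<lambda>z. of_real (cmod (D N z)))) \<le> (1 / 2) ^ N"
      using fast[of N] by simp
    then have "norm (mk_L2 (\<lambda>z. of_real (W N z)) + mk_L2 (\<lambda>z. of_real (cmod (D N z))))
        \<le> (\<Sum>k<Suc N. (1 / 2) ^ k)"
      unfolding sum.lessThan_Suc using Suc.IH by (intro norm_triangle_le add_mono) auto
    moreover have "(\<lambda>z. complex_of_real (W (Suc N) z)) =
        (\<lambda>z. of_real (W N z) + of_real (cmod (D N z)))"
      by (simp add: W_def)
    ultimately show ?case
      using Suc.IH by (simp add: sq_integrable_add mk_L2_add absD)
  qed
  have "(\<integral>\<^sup>+z. ennreal ((W N z)\<^sup>2) \<partial>circle_measure) \<le> 4" for N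
  proof -
    have "(\<integral>\<^sup>+z. ennreal ((W N z)\<^sup>2) \<partial>circle_measure) =
        ennreal (LINT z|circle_measure. (cmod (of_real (W N z)))\<^sup>2)"
      using W_bound[of N] by (subst nn_integral_eq_integral) (auto simp: sq_integrable_def)
    also have "(LINT z|circle_measure. (cmod (of_real (W N z)))\<^sup>2) =
        (norm (mk_L2 (\<lambda>z. of_real (W N z))))\<^sup>2"
      using W_bound[of N] by (simp add: norm_mk_L2 integral_nonneg)
    also have "ennreal \<dots> \<le> ennreal (2\<^sup>2)"
    proof (intro ennreal_leI power_mono)
      \<comment> \<open>The geometric sum stays below 2, which is where the bound
        \<open>4 = 2\<^sup>2\<close> comes from.\<close>
      have "(\<Sum>k<N. (1 / 2) ^ k) \<le> (2::real)"
        by (simp add: sum_gp_strict)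
      then show "norm (mk_L2 (\<lambda>z. of_real (W N z))) \<le> 2"
        using W_bound[of N] by linarith
    qed simp
    finally show ?thesis by simp
  qed
  moreover have "(\<integral>\<^sup>+z. S z \<partial>circle_measure) =
      (SUP N. \<integral>\<^sup>+z. ennreal ((W N z)\<^sup>2) \<partial>circle_measure)"
    unfolding S_def
    by (rule nn_integral_monotone_convergence_SUP)
       (auto simp: incseq_def le_fun_def W_def intro!: ennreal_leI power_mono sum_mono2 sum_nonneg)
  ultimately have S_int: "(\<integral>\<^sup>+z. S z \<partial>circle_measure) \<le> 4"
    by (simp add: SUP_least)
  then have "(\<integral>\<^sup>+z. S z \<partial>circle_measure) \<noteq> \<infinity>"
    by (auto simp: top_unique)
  then have S_fin: "AE z in circle_measure. S z \<noteq> \<infinity>"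
    by (intro nn_integral_noteq_infinite) auto
  have W_le: "W N z \<le> w z" if "S z \<noteq> \<infinity>" for N z
  proof -
    have "ennreal ((W N z)\<^sup>2) \<le> S z"
      unfolding S_def by (rule SUP_upper) simp
    also have "S z = ennreal (enn2real (S z))"
      using that by (simp add: less_top)
    finally have "ennreal ((W N z)\<^sup>2) \<le> ennreal (enn2real (S z))" .
    then have "(W N z)\<^sup>2 \<le> enn2real (S z)"
      by (subst (asm) ennreal_le_iff) auto
    then show ?thesis
      unfolding w_def by (rule real_le_rsqrt)
  qed
  have w: "sq_integrable circle_measure (\<lambda>z. of_real (w z))"
    unfolding sq_integrable_def
  proof
    have "(\<integral>\<^sup>+z. ennreal ((w z)\<^sup>2) \<partial>circle_measure) \<le> (\<integral>\<^sup>+z. S z \<partial>circle_measure)"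
      \<comment> \<open>\<open>enn2real\<close> maps infinity to 0, so the square of
        \<open>w\<close> is at most \<open>S\<close> even where \<open>S\<close> is
        infinite.\<close>
      by (intro nn_integral_mono) (auto simp: w_def ennreal_enn2real_if)
    also have "\<dots> < \<infinity>"
      using S_int by (rule le_less_trans) simp
    finally show "integrable circle_measure (\<lambda>z. (cmod (of_real (w z)))\<^sup>2)"
      by (intro integrableI_bounded) auto
  qed measurable
  \<comment> \<open>\<open>mk_L2_dominated\<close> asks for convergence and domination at every
    point, so the functions are set to 0 on the null set where \<open>S\<close> is infinite.\<close>
  define h where "h N z = (if S z = \<infinity> then 0 else f N z)" for N z
  have [measurable]: "h n \<in> borel_measurable borel" for n
    unfolding h_def by measurable
  have h_mk: "mk_L2 (h N) = mk_L2 (f N)" for N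
    by (rule mk_L2_cong_AE) (use S_fin in \<open>auto simp: h_def elim!: eventually_mono\<close>)
  have f_eq: "f N z = f 0 z + (\<Sum>k<N. D k z)" for N z
    unfolding D_def by (subst sum_lessThan_telescope) simp
  have h_lim: "(\<lambda>N. h N z) \<longlonglongrightarrow> lim (\<lambda>N. h N z)" for z
  proof (cases "S z = \<infinity>")
    case True
    then show ?thesis by (simp add: h_def)
  next
    case False
    have "summable (\<lambda>k. cmod (D k z))"
    proof (rule summableI_nonneg_bounded)
      show "(\<Sum>k<n. cmod (D k z)) \<le> w z" for n
        using W_le[OF False, of n] by (simp add: W_def)
    qed simp
    then have "summable (\<lambda>k. D k z)"
      by (rule summable_norm_cancel)
    then have "convergent (\<lambda>N. \<Sum>k<N. D k z)"
      by (simp add: summable_iff_convergent)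
    then have "convergent (\<lambda>N. f 0 z + (\<Sum>k<N. D k z))"
      by (simp add: convergent_add_const_iff)
    then have "convergent (\<lambda>N. h N z)"
      using False by (simp add: h_def f_eq[symmetric])
    then show ?thesis
      by (simp add: convergent_LIMSEQ_iff)
  qed
  have "(\<lambda>N. mk_L2 (h N)) \<longlonglongrightarrow> mk_L2 (\<lambda>z. lim (\<lambda>N. h N z))"
  proof (rule mk_L2_dominated)
    show "sq_integrable circle_measure (\<lambda>z. of_real (cmod (f 0 z)) + of_real (w z))"
      by (rule sq_integrable_add[OF sq_integrable_bound[OF f[of 0]] w]) auto
    show "cmod (h N z) \<le> cmod (of_real (cmod (f 0 z)) + of_real (w z))" for N z
    proof (cases "S z = \<infinity>")
      case False
      have "cmod (f N z) \<le> cmod (f 0 z) + W N z"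
        unfolding f_eq[of N] W_def by (intro norm_triangle_le add_left_mono norm_sum)
      also have "\<dots> \<le> cmod (f 0 z) + w z"
        using W_le[OF False] by simp
      also have "\<dots> \<le> cmod (of_real (cmod (f 0 z)) + of_real (w z))"
        by (metis abs_ge_self norm_of_real of_real_add)
      finally show ?thesis
        using False by (simp add: h_def)
    qed (simp add: h_def)
    show "(\<lambda>z. lim (\<lambda>N. h N z)) \<in> borel_measurable circle_measure"
      by (rule borel_measurable_LIMSEQ_metric[OF _ h_lim]) simp
  qed (use h_lim in auto)
  then show ?thesis
    unfolding h_mk by (rule convergentI)
qed

instance circle_L2 :: banach
proof
  fix X :: "nat \<Rightarrow> circle_L2"
  assume X: "Cauchy X"
  \<comment> \<open>A Cauchy sequence has a subsequence with geometrically small increments, and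
    converges as soon as that subsequence does.\<close>
  have "\<exists>r. \<forall>n. (\<forall>m\<ge>r n. \<forall>k\<ge>r n. dist (X m) (X k) < (1 / 2) ^ n) \<and> r n < r (Suc n)"
  proof (rule dependent_nat_choice)
    have *: "\<exists>N>N0. \<forall>m\<ge>N. \<forall>k\<ge>N. dist (X m) (X k) < (1 / 2) ^ n" for n N0
    proof -
      obtain M where "\<forall>m\<ge>M. \<forall>k\<ge>M. dist (X m) (X k) < (1 / 2) ^ n"
        using metric_CauchyD[OF X, of "(1 / 2) ^ n"] by auto
      then show ?thesis
        by (intro exI[of _ "max M (Suc N0)"]) auto
    qed
    from *[of _ 0] show "\<exists>N. \<forall>m\<ge>N. \<forall>k\<ge>N. dist (X m) (X k) < (1 / 2) ^ 0" by blast
    from * show "\<exists>N. (\<forall>m\<ge>N. \<forall>k\<ge>N. dist (X m) (X k) < (1 / 2) ^ Suc n) \<and> N0 < N" for N0 n by blast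
  qed
  then obtain r where r: "\<And>n m k. r n \<le> m \<Longrightarrow> r n \<le> k \<Longrightarrow> dist (X m) (X k) < (1 / 2) ^ n"
    "\<And>n. r n < r (Suc n)" by blast
  have "\<exists>f. sq_integrable circle_measure f \<and> X (r n) = mk_L2 f" for n
    using mk_L2_cases by metis
  then obtain f where f: "\<And>n. sq_integrable circle_measure (f n)" "\<And>n. X (r n) = mk_L2 (f n)"
    by metis
  have "convergent (\<lambda>n. mk_L2 (f n))"
  proof (rule convergent_mk_L2_fast[OF f(1)])
    show "norm (mk_L2 (f (Suc n)) - mk_L2 (f n)) \<le> (1 / 2) ^ n" for n
      using r(1)[of n "r (Suc n)" "r n"] r(2)[of n] by (simp add: f(2) dist_norm)
  qed
  then obtain L where "(X \<circ> r) \<longlonglongrightarrow> L"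
    by (auto simp: convergent_def f(2) o_def)
  moreover have "strict_mono r"
    using r(2) by (simp add: strict_mono_Suc_iff)
  ultimately have "X \<longlonglongrightarrow> L"
    using X Cauchy_converges_subseq by blast
  then show "convergent X" by (rule convergentI)
qed

text \<open>By orthogonality the squared distance of two nested partial sums is a difference of
  partial sums of squares. The net of partial sums is therefore Cauchy, and completeness gives its
  limit.\<close>

lemma summable_on_fourier_term:
  assumes "(\<lambda>n. (cmod (a n))\<^sup>2) summable_on A"
  shows "(\<lambda>n. fourier_term n (a n)) summable_on A"
proof -
  let ?s = "sum (\<lambda>n. fourier_term n (a n))"
  have real_close: "u - v < e" if "dist u l < e / 2" "dist v l < e / 2" for u v l e :: real
    using that by (simp add: dist_real_def abs_if split: if_splits)
  obtain L where L: "(sum (\<lambda>n. (cmod (a n))\<^sup>2) \<longlongrightarrow> L) (finite_subsets_at_top A)"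
    using assms by (auto simp: summable_on_def has_sum_def)
  have "cauchy_filter (filtermap ?s (finite_subsets_at_top A))"
    unfolding cauchy_filter_metric_filtermap
  proof (intro allI impI)
    fix e :: real assume "e > 0"
    \<comment> \<open>Two sums of squares this close to \<open>L\<close> differ by less than
      \<open>(e / 2)\<^sup>2\<close>, so a partial sum beyond \<open>F0\<close> is within
      \<open>e / 2\<close> of the one at \<open>F0\<close>; two such partial sums are then within
      \<open>e\<close>.\<close>
    then have d: "(e / 2)\<^sup>2 / 2 > 0" by simp
    have "\<exists>F0. finite F0 \<and> F0 \<subseteq> A \<and> (\<forall>F. finite F \<and> F0 \<subseteq> F \<and> F \<subseteq> A \<longrightarrow>
        dist (\<Sum>n\<in>F. (cmod (a n))\<^sup>2) L < (e / 2)\<^sup>2 / 2)"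
      using tendstoD[OF L d] by (simp only: eventually_finite_subsets_at_top)
    then obtain F0 where F0: "finite F0" "F0 \<subseteq> A"
        "\<forall>F. finite F \<and> F0 \<subseteq> F \<and> F \<subseteq> A \<longrightarrow> dist (\<Sum>n\<in>F. (cmod (a n))\<^sup>2) L < (e / 2)\<^sup>2 / 2"
      by (elim exE conjE)
    note near = F0(3)[rule_format, OF conjI[OF _ conjI]]
    have close: "dist (?s F) (?s F0) < e / 2" if F: "finite F" "F0 \<subseteq> F" "F \<subseteq> A" for F
    proof -
      have "?s F - ?s F0 = ?s (F - F0)"
        using F by (intro sum_diff[symmetric])
      then have "(dist (?s F) (?s F0))\<^sup>2 = (\<Sum>n\<in>F - F0. (cmod (a n))\<^sup>2)"
        using norm_sum_fourier_term[of "F - F0" a] F(1) by (simp add: dist_norm)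
      also have "\<dots> = (\<Sum>n\<in>F. (cmod (a n))\<^sup>2) - (\<Sum>n\<in>F0. (cmod (a n))\<^sup>2)"
        using F by (intro sum_diff)
      also have "\<dots> < (e / 2)\<^sup>2"
        using near[OF F] near[OF F0(1) order_refl F0(2)] by (rule real_close)
      finally show ?thesis
        by (rule power2_less_imp_less) (use \<open>e > 0\<close> in simp)
    qed
    show "\<exists>P. eventually P (finite_subsets_at_top A) \<and>
        (\<forall>F F'. P F \<and> P F' \<longrightarrow> dist (?s F) (?s F') < e)"
    proof (intro exI[of _ "\<lambda>F. finite F \<and> F0 \<subseteq> F \<and> F \<subseteq> A"] conjI allI impI)
      show "\<forall>\<^sub>F F in finite_subsets_at_top A. finite F \<and> F0 \<subseteq> F \<and> F \<subseteq> A"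
        unfolding eventually_finite_subsets_at_top using F0 by blast
      show "dist (?s F) (?s F') < e"
        if "(finite F \<and> F0 \<subseteq> F \<and> F \<subseteq> A) \<and> (finite F' \<and> F0 \<subseteq> F' \<and> F' \<subseteq> A)" for F F'
        using that close[of F] close[of F'] dist_triangle2[of "?s F" "?s F'" "?s F0"] by linarith
    qed
  qed
  moreover have "complete (UNIV :: circle_L2 set)"
    by (meson Cauchy_convergent UNIV_I complete_def convergent_def)
  ultimately obtain L' where "filtermap ?s (finite_subsets_at_top A) \<le> nhds L'"
    using cauchy_filter_complete_converges[of "filtermap ?s (finite_subsets_at_top A)" UNIV]
    by (auto simp: filtermap_bot_iff)
  then have "(?s \<longlongrightarrow> L') (finite_subsets_at_top A)"
    by (simp add: filterlim_def)
  then show ?thesis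
    using summable_on_def has_sum_def by blast
qed

text \<open>The coefficient functional is bounded and linear, so it may be applied term by term, and
  at most one term survives.\<close>

lemma fourier_coeff_has_sum:
  assumes "((\<lambda>n. fourier_term n (a n)) has_sum f) A"
  shows "fourier_coeff f m = (if m \<in> A then a m else 0)"
proof -
  have "((\<lambda>n. if n = m then a n else 0) has_sum fourier_coeff f m) A"
    using has_sum_bounded_linear[OF bounded_linear_fourier_coeff assms, of m]
    by (simp add: fourier_coeff_fourier_term)
  moreover have "((\<lambda>n. if n = m then a n else 0) has_sum (if m \<in> A then a m else 0)) A"
    by (rule has_sum_finite_neutralI[where B = "A \<inter> {m}"]) auto
  ultimately show ?thesis
    by (rule has_sum_unique)
qed

section \<open>The Riesz projector and the semigroup as Fourier multipliers\<close>

lemma riesz_projector_has_sum: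
  "((\<lambda>n. fourier_term n (fourier_coeff f n)) has_sum riesz_projector f) {0..}"
  unfolding riesz_projector_def fourier_term_def[symmetric]
  by (intro has_sum_infsum summable_on_fourier_term bessel_summable)

lemma fourier_coeff_riesz_projector:
  "fourier_coeff (riesz_projector f) n = (if 0 \<le> n then fourier_coeff f n else 0)"
  using fourier_coeff_has_sum[OF riesz_projector_has_sum] by simp

lemma fourier_coeff_semigroup_absD:
  assumes "0 \<le> t"
  shows "fourier_coeff (semigroup_absD t f) n = fourier_coeff f n * of_real (exp (- (\<bar>real_of_int n\<bar> * t)))"
proof -
  \<comment> \<open>Summability has to be established because an infinite sum that does not converge
    is 0 by convention. Here \<open>t \<ge> 0\<close> makes the exponential factor at most
    1.\<close>
  have "(\<lambda>n. (cmod (fourier_coeff f n * of_real (exp (- (\<bar>real_of_int n\<bar> * t)))))\<^sup>2) summable_on UNIV"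
  proof (rule summable_on_comparison_test[OF bessel_summable])
    fix n :: int
    have "cmod (fourier_coeff f n * of_real (exp (- (\<bar>real_of_int n\<bar> * t)))) \<le> cmod (fourier_coeff f n)"
      using assms by (simp add: norm_mult mult_left_le)
    then show "(cmod (fourier_coeff f n * of_real (exp (- (\<bar>real_of_int n\<bar> * t)))))\<^sup>2
        \<le> (cmod (fourier_coeff f n))\<^sup>2"
      by (rule power_mono) simp
  qed simp
  then have "((\<lambda>n. fourier_term n (fourier_coeff f n * of_real (exp (- (\<bar>real_of_int n\<bar> * t)))))
      has_sum semigroup_absD t f) UNIV"
    unfolding semigroup_absD_def fourier_term_def[symmetric]
    by (intro has_sum_infsum summable_on_fourier_term)
  from fourier_coeff_has_sum[OF this] show ?thesis by simp
qed

section \<open>Abel means\<close>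

lemma mk_L2_sum:
  assumes "finite N" "\<And>n. n \<in> N \<Longrightarrow> sq_integrable circle_measure (f n)"
  shows "sq_integrable circle_measure (\<lambda>z. \<Sum>n\<in>N. f n z) \<and>
    mk_L2 (\<lambda>z. \<Sum>n\<in>N. f n z) = (\<Sum>n\<in>N. mk_L2 (f n))"
  using assms by (induction N) (simp_all add: mk_L2_zero mk_L2_add sq_integrable_add)

text \<open>Nonnegative and negative frequencies will each be enumerated by the naturals;
  injectivity of the enumeration keeps the terms orthogonal.\<close>

lemma norm_sum_fourier_term_reindex:
  fixes \<sigma> :: "nat \<Rightarrow> int"
  assumes "inj \<sigma>"
  shows "(norm (\<Sum>n<N. fourier_term (\<sigma> n) (d n)))\<^sup>2 = (\<Sum>n<N. (cmod (d n))\<^sup>2)"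
proof -
  have inj: "inj_on \<sigma> {..<N}"
    using assms by (rule inj_on_subset) simp
  have "(\<Sum>n<N. fourier_term (\<sigma> n) (d n)) = (\<Sum>m\<in>\<sigma> ` {..<N}. fourier_term m (d (inv \<sigma> m)))"
    by (simp add: sum.reindex[OF inj] inv_f_f[OF assms])
  then have "(norm (\<Sum>n<N. fourier_term (\<sigma> n) (d n)))\<^sup>2 =
      (\<Sum>m\<in>\<sigma> ` {..<N}. (cmod (d (inv \<sigma> m)))\<^sup>2)"
    using norm_sum_fourier_term[of "\<sigma> ` {..<N}" "\<lambda>m. d (inv \<sigma> m)"] by simp
  also have "\<dots> = (\<Sum>n<N. (cmod (d n))\<^sup>2)"
    by (simp add: sum.reindex[OF inj] inv_f_f[OF assms])
  finally show ?thesis .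
qed

text \<open>The coefficients are bounded by \<open>B * r ^ n\<close>, so the series converges
  uniformly on the circle. The circle has total mass 1, hence a uniform bound on the tail is also a
  bound on its norm in \<open>circle_L2\<close>.\<close>

lemma abel_mean:
  fixes a :: "nat \<Rightarrow> complex" and \<sigma> :: "nat \<Rightarrow> int"
  assumes bdd: "\<And>n. cmod (a n) \<le> B" and r: "0 \<le> r" "r < 1"
  defines "p \<equiv> \<lambda>z. \<Sum>n. a n * of_real r ^ n * z powi \<sigma> n"
  shows sq_integrable_abel_mean: "sq_integrable circle_measure p"
    and abel_mean_sums: "(\<lambda>n. fourier_term (\<sigma> n) (a n * of_real r ^ n)) sums mk_L2 p"
proof -
  define b where "b n = a n * of_real r ^ n" for n
  have b: "summable (\<lambda>n. cmod (b n))"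
  proof (rule summable_comparison_test')
    show "summable (\<lambda>n. B * r ^ n)"
      using r by (intro summable_mult summable_geometric) simp
    show "norm (cmod (b n)) \<le> B * r ^ n" if "n \<ge> 0" for n
      using bdd[of n] r by (simp add: b_def norm_mult norm_power mult_right_mono)
  qed
  have [measurable]: "p \<in> borel_measurable borel"
    unfolding p_def by measurable
  have norm_b: "cmod (b n * z powi \<sigma> n) = cmod (b n)" if "cmod z = 1" for n z
    using that by (simp add: norm_mult norm_power_int)
  have bound: "cmod (p z - (\<Sum>n<N. b n * z powi \<sigma> n)) \<le> (\<Sum>n. cmod (b (n + N)))" if z: "cmod z = 1" for N z
  proof -
    have sm: "summable (\<lambda>n. cmod (b n * z powi \<sigma> n))"
      using b by (simp add: norm_b[OF z])
    have "p z - (\<Sum>n<N. b n * z powi \<sigma> n) = (\<Sum>n. b (n + N) * z powi \<sigma> (n + N))"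
      unfolding p_def b_def[symmetric]
      by (rule suminf_minus_initial_segment[symmetric, OF summable_norm_cancel[OF sm]])
    also have "cmod \<dots> \<le> (\<Sum>n. cmod (b (n + N) * z powi \<sigma> (n + N)))"
      by (rule summable_norm) (use summable_ignore_initial_segment[OF sm, of N] in simp)
    finally show ?thesis
      by (simp add: norm_b[OF z])
  qed
  have AE_bound: "AE z in circle_measure. cmod (p z - (\<Sum>n<N. b n * z powi \<sigma> n)) \<le> (\<Sum>n. cmod (b (n + N)))" for N
    using AE_circle_norm by eventually_elim (rule bound)
  show p: "sq_integrable circle_measure p"
    by (rule sq_integrable_AE_bounded[OF _ AE_bound[of 0, simplified]]) measurable
  have "norm ((\<Sum>n<N. fourier_term (\<sigma> n) (b n)) - mk_L2 p) \<le> (\<Sum>n. cmod (b (n + N)))" for N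
  proof -
    have s: "sq_integrable circle_measure (\<lambda>z. \<Sum>n<N. b n * z powi \<sigma> n)"
        "mk_L2 (\<lambda>z. \<Sum>n<N. b n * z powi \<sigma> n) = (\<Sum>n<N. fourier_term (\<sigma> n) (b n))"
      using mk_L2_sum[of "{..<N}" "\<lambda>n z. b n * z powi \<sigma> n"]
      by (auto simp: sq_integrable_powi fourier_term_def)
    have "norm (mk_L2 (\<lambda>z. p z - (\<Sum>n<N. b n * z powi \<sigma> n))) \<le> (\<Sum>n. cmod (b (n + N)))"
    proof (rule norm_mk_L2_le[OF _ AE_bound])
      show "0 \<le> (\<Sum>n. cmod (b (n + N)))"
        by (rule suminf_nonneg[OF summable_ignore_initial_segment[OF b]]) simp
    qed measurable
    then show ?thesis
      by (simp add: mk_L2_diff[OF p s(1)] s(2) norm_minus_commute)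
  qed
  moreover have "(\<lambda>N. \<Sum>n. cmod (b (n + N))) \<longlonglongrightarrow> 0"
    by (rule suminf_exist_split2[OF b])
  ultimately have "(\<lambda>N. (\<Sum>n<N. fourier_term (\<sigma> n) (b n)) - mk_L2 p) \<longlonglongrightarrow> 0"
    by (rule Lim_null_comparison[OF always_eventually[OF allI]])
  then have "(\<lambda>n. fourier_term (\<sigma> n) (b n)) sums mk_L2 p"
    unfolding sums_def by (rule LIM_zero_cancel)
  then show "(\<lambda>n. fourier_term (\<sigma> n) (a n * of_real r ^ n)) sums mk_L2 p"
    by (simp only: b_def)
qed

text \<open>Parseval turns the squared error into the sum of
  \<open>(cmod (a n))\<^sup>2 * (1 - r k ^ n)\<^sup>2\<close>. Each term tends to 0 and is dominated
  by \<open>(cmod (a n))\<^sup>2\<close>, so Tannery's theorem applies.\<close>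

lemma abel_mean_tendsto:
  fixes a :: "nat \<Rightarrow> complex" and \<sigma> :: "nat \<Rightarrow> int" and r :: "nat \<Rightarrow> real"
  assumes inj: "inj \<sigma>" and sq: "summable (\<lambda>n. (cmod (a n))\<^sup>2)"
    and \<phi>: "(\<lambda>n. fourier_term (\<sigma> n) (a n)) sums \<phi>"
    and r: "\<And>k. 0 \<le> r k" "\<And>k. r k < 1" "r \<longlonglongrightarrow> 1"
  shows "(\<lambda>k. mk_L2 (\<lambda>z. \<Sum>n. a n * of_real (r k) ^ n * z powi \<sigma> n)) \<longlonglongrightarrow> \<phi>"
proof -
  define P where "P k = mk_L2 (\<lambda>z. \<Sum>n. a n * of_real (r k) ^ n * z powi \<sigma> n)" for k
  obtain B where "\<And>n. norm ((cmod (a n))\<^sup>2) \<le> B"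
    using summable_imp_bounded[OF sq] by (auto simp: bounded_iff)
  then have bdd: "cmod (a n) \<le> sqrt B" for n
    by (intro real_le_rsqrt) simp
  have eq: "(norm (P k - \<phi>))\<^sup>2 = (\<Sum>n. (cmod (a n))\<^sup>2 * (1 - r k ^ n)\<^sup>2)" for k
  proof -
    have "(\<lambda>n. fourier_term (\<sigma> n) (a n * of_real (r k) ^ n) - fourier_term (\<sigma> n) (a n)) sums (P k - \<phi>)"
      unfolding P_def by (intro sums_diff abel_mean_sums[OF bdd r(1,2)] \<phi>)
    then have "(\<lambda>n. fourier_term (\<sigma> n) (a n * of_real (r k) ^ n - a n)) sums (P k - \<phi>)"
      by (simp add: fourier_term_diff)
    then have "(\<lambda>N. (norm (\<Sum>n<N. fourier_term (\<sigma> n) (a n * of_real (r k) ^ n - a n)))\<^sup>2)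
        \<longlonglongrightarrow> (norm (P k - \<phi>))\<^sup>2"
      unfolding sums_def by (intro tendsto_intros)
    then have "(\<lambda>n. (cmod (a n * of_real (r k) ^ n - a n))\<^sup>2) sums (norm (P k - \<phi>))\<^sup>2"
      by (simp add: norm_sum_fourier_term_reindex[OF inj] sums_def)
    moreover have "(cmod (a n * of_real (r k) ^ n - a n))\<^sup>2 = (cmod (a n))\<^sup>2 * (1 - r k ^ n)\<^sup>2" for n
    proof -
      have "a n * of_real (r k) ^ n - a n = a n * of_real (r k ^ n - 1)"
        by (simp add: algebra_simps)
      then show ?thesis
        by (simp only: norm_mult norm_of_real power_mult_distrib power2_abs) (simp add: power2_commute)
    qed
    ultimately show ?thesis
      by (simp add: sums_iff)
  qed
  have "(\<lambda>k. \<Sum>n. (cmod (a n))\<^sup>2 * (1 - r k ^ n)\<^sup>2) \<longlonglongrightarrow> (\<Sum>n. 0)"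
  proof (rule tannerys_theorem[THEN conjunct2, THEN conjunct2])
    show "summable (\<lambda>n. (cmod (a n))\<^sup>2)" by (rule sq)
    show "(\<lambda>k. (cmod (a n))\<^sup>2 * (1 - r k ^ n)\<^sup>2) \<longlonglongrightarrow> 0" for n
      by (rule tendsto_eq_intros refl r(3))+ simp
    have "norm ((cmod (a n))\<^sup>2 * (1 - r k ^ n)\<^sup>2) \<le> (cmod (a n))\<^sup>2" for n k
    proof -
      have "0 \<le> r k ^ n" "r k ^ n \<le> 1"
        using r(1,2)[of k] by (auto intro: power_le_one)
      then have "(1 - r k ^ n)\<^sup>2 \<le> 1"
        by (intro power_le_one) auto
      then show ?thesis
        by (simp add: mult_left_le)
    qed
    then show "\<forall>\<^sub>F (n, k) in at_top \<times>\<^sub>F sequentially.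
        norm ((cmod (a n))\<^sup>2 * (1 - r k ^ n)\<^sup>2) \<le> (cmod (a n))\<^sup>2"
      by (intro always_eventually) auto
  qed simp
  then have "(\<lambda>k. (norm (P k - \<phi>))\<^sup>2) \<longlonglongrightarrow> 0"
    by (simp add: eq)
  from tendsto_real_sqrt[OF this] have "(\<lambda>k. P k - \<phi>) \<longlonglongrightarrow> 0"
    by (simp add: tendsto_norm_zero_iff)
  then show ?thesis
    unfolding P_def by (rule LIM_zero_cancel)
qed

section \<open>Cauchy transforms\<close>

text \<open>Sum and integral are exchanged because the terms are dominated by
  \<open>cmod (h p) * (B * cmod x) ^ n\<close>. The bound on \<open>\<kappa>\<close> is asked only
  where \<open>h\<close> is nonzero; elsewhere both sides have integrand 0.\<close>

lemma integral_geometric_series: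
  fixes h \<kappa> :: "'a \<Rightarrow> complex"
  assumes h: "integrable M h" and [measurable]: "\<kappa> \<in> borel_measurable M"
    and B: "\<And>p. h p \<noteq> 0 \<Longrightarrow> cmod (\<kappa> p) \<le> B" "0 \<le> B" "B * cmod x < 1"
  shows "(\<lambda>n. (LINT p|M. h p * \<kappa> p ^ n) * x ^ n) sums (LINT p|M. h p / (1 - \<kappa> p * x))"
proof -
  note [measurable] = borel_measurable_integrable[OF h]
  define f where "f n p = h p * \<kappa> p ^ n * x ^ n" for n p
  have [measurable]: "f n \<in> borel_measurable M" for n
    unfolding f_def by measurable
  have f_le: "cmod (f n p) \<le> cmod (h p) * (B * cmod x) ^ n" for n p
  proof (cases "h p = 0")
    case False
    then have "cmod (\<kappa> p) ^ n \<le> B ^ n"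
      using B(1) by (intro power_mono) auto
    then have "cmod (h p) * (cmod (\<kappa> p) ^ n * cmod x ^ n) \<le> cmod (h p) * (B ^ n * cmod x ^ n)"
      by (intro mult_left_mono mult_right_mono) auto
    then show ?thesis
      by (simp add: f_def norm_mult norm_power power_mult_distrib mult.assoc)
  qed (simp add: f_def)
  have geo: "summable (\<lambda>n. C * (B * cmod x) ^ n)" for C
    using B(2,3) by (intro summable_mult summable_geometric) simp
  have int: "integrable M (f n)" for n
    by (rule Bochner_Integration.integrable_bound[of _ "\<lambda>p. cmod (h p) * (B * cmod x) ^ n"])
       (use h f_le B(2) in auto)
  have "(\<lambda>n. integral\<^sup>L M (f n)) sums (LINT p|M. (\<Sum>n. f n p))"
  proof (rule sums_integral[OF int])
    show "AE p in M. summable (\<lambda>n. norm (f n p))"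
      by (intro AE_I2 summable_comparison_test'[OF geo]) (use f_le in auto)
    show "summable (\<lambda>n. LINT p|M. norm (f n p))"
    proof (rule summable_comparison_test'[OF geo])
      fix n
      have "(LINT p|M. norm (f n p)) \<le> (LINT p|M. cmod (h p) * (B * cmod x) ^ n)"
        using int h f_le by (intro integral_mono) auto
      then show "norm (LINT p|M. norm (f n p)) \<le> (LINT p|M. cmod (h p)) * (B * cmod x) ^ n"
        by simp
    qed
  qed
  moreover have "(\<Sum>n. f n p) = h p / (1 - \<kappa> p * x)" for p
  proof (cases "h p = 0")
    case False
    have "cmod (\<kappa> p * x) \<le> B * cmod x"
      using B(1)[OF False] by (simp add: norm_mult mult_right_mono)
    then have "cmod (\<kappa> p * x) < 1"
      using B(3) by linarith
    then have "(\<lambda>n. h p * (\<kappa> p * x) ^ n) sums (h p * (1 / (1 - \<kappa> p * x)))"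
      by (intro sums_mult geometric_sums)
    then show ?thesis
      by (simp add: f_def sums_iff power_mult_distrib mult.assoc)
  qed (simp add: f_def)
  moreover have "integral\<^sup>L M (f n) = (LINT p|M. h p * \<kappa> p ^ n) * x ^ n" for n
    unfolding f_def by simp
  ultimately show ?thesis by simp
qed

text \<open>The Cauchy kernel is written as \<open>1 / (q - w0)\<close> times the geometric series
  of ratio \<open>(w - w0) / (q - w0)\<close>, whose modulus stays below 1 on the disk of radius
  \<open>\<epsilon>\<close>.\<close>

lemma cauchy_transform_expansion:
  fixes H q :: "'a \<Rightarrow> complex"
  assumes H: "integrable M H" and [measurable]: "q \<in> borel_measurable M"
    and far: "\<And>p. H p \<noteq> 0 \<Longrightarrow> \<epsilon> \<le> cmod (q p - w0)" and w: "cmod (w - w0) < \<epsilon>"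
  shows "(\<lambda>n. (LINT p|M. H p / (q p - w0) ^ Suc n) * (w - w0) ^ n) sums (LINT p|M. H p / (q p - w))"
proof -
  note [measurable] = borel_measurable_integrable[OF H]
  have eps: "\<epsilon> > 0"
    using w norm_ge_zero[of "w - w0"] by linarith
  have inv: "cmod (1 / (q p - w0)) \<le> 1 / \<epsilon>" if "H p \<noteq> 0" for p
    using far[OF that] eps by (simp add: norm_divide frac_le)
  have int: "integrable M (\<lambda>p. H p / (q p - w0))"
  proof (rule Bochner_Integration.integrable_bound[of _ "\<lambda>p. H p * of_real (1 / \<epsilon>)"])
    show "AE p in M. cmod (H p / (q p - w0)) \<le> cmod (H p * of_real (1 / \<epsilon>))"
    proof (rule AE_I2)
      show "cmod (H p / (q p - w0)) \<le> cmod (H p * of_real (1 / \<epsilon>))" for p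
        using mult_left_mono[OF inv[of p], of "cmod (H p)"] eps
        by (cases "H p = 0") (simp_all add: norm_mult norm_divide)
    qed
  qed (use H in auto)
  have "(\<lambda>n. (LINT p|M. H p / (q p - w0) * (1 / (q p - w0)) ^ n) * (w - w0) ^ n) sums
      (LINT p|M. H p / (q p - w0) / (1 - 1 / (q p - w0) * (w - w0)))"
  proof (rule integral_geometric_series[OF int, where B = "1 / \<epsilon>"])
    show "1 / \<epsilon> * cmod (w - w0) < 1"
      using w eps by simp
  qed (use inv eps in auto)
  moreover have "H p / (q p - w0) / (1 - 1 / (q p - w0) * (w - w0)) = H p / (q p - w)" for p
  proof (cases "H p = 0")
    case False
    then have "q p - w0 \<noteq> 0"
      using far[OF False] eps by auto
    then have "(q p - w0) * (1 - 1 / (q p - w0) * (w - w0)) = q p - w"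
      by (simp add: field_simps)
    then show ?thesis
      by (simp only: divide_divide_eq_left)
  qed simp
  moreover have "H p / (q p - w0) * (1 / (q p - w0)) ^ n = H p / (q p - w0) ^ Suc n" for p n
    by (simp add: power_divide)
  ultimately show ?thesis
    by (simp only:)
qed

lemma cauchy_transform_holomorphic:
  fixes H q :: "'a \<Rightarrow> complex"
  assumes H: "integrable M H" and q: "q \<in> borel_measurable M"
    and K: "closed K" "\<And>p. H p \<noteq> 0 \<Longrightarrow> q p \<in> K"
  shows "(\<lambda>w. LINT p|M. H p / (q p - w)) holomorphic_on - K"
  unfolding holomorphic_on_def
proof
  \<comment> \<open>Holomorphy is local: a disk around \<open>w0\<close> that avoids
    \<open>K\<close> keeps \<open>q\<close> at distance at least \<open>\<epsilon>\<close> wherever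
    \<open>H\<close> is nonzero, and there the transform is a power series.\<close>
  fix w0 assume "w0 \<in> - K"
  then obtain \<epsilon> where \<epsilon>: "\<epsilon> > 0" "ball w0 \<epsilon> \<subseteq> - K"
    using K(1) by (meson open_Compl open_contains_ball)
  have "(\<lambda>w. LINT p|M. H p / (q p - w)) holomorphic_on ball w0 \<epsilon>"
  proof (rule power_series_holomorphic)
    fix w assume w: "w \<in> ball w0 \<epsilon>"
    show "(\<lambda>n. (LINT p|M. H p / (q p - w0) ^ Suc n) * (w - w0) ^ n) sums (LINT p|M. H p / (q p - w))"
    proof (rule cauchy_transform_expansion[OF H q])
      show "\<epsilon> \<le> cmod (q p - w0)" if "H p \<noteq> 0" for p
      proof (rule ccontr)
        assume "\<not> \<epsilon> \<le> cmod (q p - w0)"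
        then have "q p \<in> ball w0 \<epsilon>" by (simp add: dist_norm norm_minus_commute)
        then show False using K(2)[OF that] \<epsilon>(2) by auto
      qed
    qed (use w in \<open>simp add: dist_norm norm_minus_commute\<close>)
  qed
  then show "(\<lambda>w. LINT p|M. H p / (q p - w)) field_differentiable at w0 within - K"
    using holomorphic_on_imp_differentiable_at[OF _ open_ball] \<epsilon>(1)
      field_differentiable_at_within by (metis centre_in_ball)
qed

text \<open>Inside the disk the power series continues the Cauchy transform up to the circle, and outside
  it is the Laurent tail that equals minus the same transform; off \<open>K\<close> the two boundary
  values agree.\<close>

lemma cauchy_transform_boundary:
  fixes H q :: "'a \<Rightarrow> complex" and a :: "int \<Rightarrow> complex"
  assumes H: "integrable M H" and [measurable]: "q \<in> borel_measurable M"
    and K: "closed K" "K \<subseteq> cball 0 1" "0 \<notin> K" "\<And>p. H p \<noteq> 0 \<Longrightarrow> q p \<in> K"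
    and star: "\<And>w t. w \<notin> K \<Longrightarrow> cmod w \<le> 1 \<Longrightarrow> 0 \<le> t \<Longrightarrow> t \<le> 1 \<Longrightarrow> of_real t * w \<notin> K"
    and a: "\<And>n. a n = (LINT p|M. H p * q p powi (- n - 1))"
    and summable: "\<And>w. cmod w < 1 \<Longrightarrow> summable (\<lambda>n. a (int n) * w ^ n)"
    and z: "cmod z = 1" "z \<notin> K"
    and r: "\<And>k. 0 < r k" "\<And>k. r k < 1" "r \<longlonglongrightarrow> 1"
  shows "(\<lambda>k. (\<Sum>n. a (int n) * of_real (r k) ^ n * z powi int n) +
      (\<Sum>n. a (- 1 - int n) * of_real (r k) ^ n * z powi (- 1 - int n))) \<longlonglongrightarrow> 0"
proof -
  define C where "C w = (LINT p|M. H p / (q p - w))" for w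
  define f where "f w = (\<Sum>n. a (int n) * w ^ n)" for w
  have C: "C holomorphic_on - K"
    unfolding C_def using H K by (intro cauchy_transform_holomorphic) auto
  have f: "f holomorphic_on ball 0 1"
  proof (rule power_series_holomorphic)
    show "(\<lambda>n. a (int n) * (w - 0) ^ n) sums f w" if "w \<in> ball 0 1" for w
      using summable_sums[OF summable, of w] that by (simp add: f_def)
  qed
  obtain \<delta> where \<delta>: "\<delta> > 0" "ball 0 \<delta> \<subseteq> - K"
    using K(1,3) by (meson ComplI open_Compl open_contains_ball)
  define S where "S = ball 0 1 \<inter> - K"
  \<comment> \<open>Near 0 the Taylor coefficients of \<open>C\<close> are the moments
    \<open>a n\<close> with \<open>n \<ge> 0\<close>, by the expansion centred at 0.\<close>
  have f_eq_C_near: "f w = C w" if w: "cmod w < \<delta>" for w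
  proof -
    have "(\<lambda>n. (LINT p|M. H p / (q p - 0) ^ Suc n) * (w - 0) ^ n) sums (LINT p|M. H p / (q p - w))"
    proof (rule cauchy_transform_expansion[OF H])
      show "\<delta> \<le> cmod (q p - 0)" if "H p \<noteq> 0" for p
        using K(4)[OF that] \<delta>(2) by (force simp: not_le)
    qed (use w in auto)
    moreover have "(LINT p|M. H p / (q p - 0) ^ Suc n) = a (int n)" for n
    proof -
      have "- int n - 1 = - int (Suc n)" by simp
      then show ?thesis
        by (simp only: a power_int_minus power_int_of_nat divide_inverse diff_zero)
    qed
    ultimately show ?thesis
      by (simp add: f_def C_def sums_iff)
  qed
  \<comment> \<open>The identity theorem carries the equality from the small disk to all of
    \<open>S\<close>, which is connected because it is star-shaped about 0.\<close>
  have f_eq_C: "f w = C w" if w: "w \<in> S" for w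
  proof -
    have "f w - C w = 0"
    proof (rule analytic_continuation[of "\<lambda>w. f w - C w" S "S \<inter> ball 0 \<delta>" 0])
      show "(\<lambda>w. f w - C w) holomorphic_on S"
        unfolding S_def using f C by (intro holomorphic_intros) (auto intro: holomorphic_on_subset)
      show "open S"
        unfolding S_def using K(1) by (intro open_Int open_ball open_Compl)
      have "starlike S"
        unfolding starlike_def
      proof (intro bexI ballI subsetI)
        show "0 \<in> S" using K(3) by (simp add: S_def)
        fix x y assume x: "x \<in> S" and "y \<in> closed_segment 0 x"
        then obtain t where t: "0 \<le> t" "t \<le> 1" "y = of_real t * x"
          by (auto simp: closed_segment_def scaleR_conv_of_real)
        have "t * cmod x \<le> cmod x"
          using t by (simp add: mult_left_le_one_le)
        then show "y \<in> S"
          using x star[of x t] t by (auto simp: S_def norm_mult)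
      qed
      then show "connected S" by (rule starlike_imp_connected)
      show "0 islimpt S \<inter> ball 0 \<delta>"
      proof (rule interior_limit_point)
        have "interior (S \<inter> ball 0 \<delta>) = S \<inter> ball 0 \<delta>"
          using \<open>open S\<close> by (intro interior_open open_Int open_ball)
        then show "0 \<in> interior (S \<inter> ball 0 \<delta>)"
          using K(3) \<delta>(1) by (simp add: S_def)
      qed
      show "f w - C w = 0" if "w \<in> S \<inter> ball 0 \<delta>" for w
        using f_eq_C_near[of w] that by simp
    qed (use K(3) w in \<open>auto simp: S_def\<close>)
    then show ?thesis by simp
  qed
  have zr: "of_real (r k) * z \<in> S" for k
    using star[of z "r k"] z r(1,2)[of k] by (auto simp: S_def norm_mult)
  have inside: "(\<Sum>n. a (int n) * of_real (r k) ^ n * z powi int n) = C (of_real (r k) * z)" for k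
    using f_eq_C[OF zr] by (simp add: f_def power_mult_distrib mult.assoc)
  have z0: "z \<noteq> 0" using z by auto
  have outside: "(\<Sum>n. a (- 1 - int n) * of_real (r k) ^ n * z powi (- 1 - int n)) =
      - (C (z / of_real (r k)) / of_real (r k))" for k
  proof -
    \<comment> \<open>The inverse of the exterior point \<open>z / r k\<close>: the geometric series
      in \<open>q p * x\<close> is the expansion of the Cauchy kernel at infinity, convergent since
      \<open>q\<close> stays in the closed unit disk.\<close>
    define x where "x = of_real (r k) / z"
    have "(\<lambda>n. (LINT p|M. H p * q p ^ n) * x ^ n) sums (LINT p|M. H p / (1 - q p * x))"
    proof (rule integral_geometric_series[OF H, where B = 1])
      show "cmod (q p) \<le> 1" if "H p \<noteq> 0" for p
        using K(2) K(4)[OF that] by auto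
      show "1 * cmod x < 1"
        using r(1,2)[of k] z by (simp add: x_def norm_divide)
    qed auto
    from sums_mult[OF this, of "1 / z"]
    have "(\<lambda>n. 1 / z * ((LINT p|M. H p * q p ^ n) * x ^ n)) sums
        (1 / z * (LINT p|M. H p / (1 - q p * x)))" .
    moreover have "1 / z * ((LINT p|M. H p * q p ^ n) * x ^ n) =
        a (- 1 - int n) * of_real (r k) ^ n * z powi (- 1 - int n)" for n
    proof -
      have "- 1 - int n = - int (Suc n)" by simp
      then have "z powi (- 1 - int n) = 1 / z * (1 / z) ^ n"
        by (simp only: power_int_minus power_int_of_nat) (simp add: field_simps)
      moreover have "a (- 1 - int n) = (LINT p|M. H p * q p ^ n)"
        by (simp add: a)
      ultimately show ?thesis
        by (simp add: x_def power_divide)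
    qed
    moreover have "1 / z * (LINT p|M. H p / (1 - q p * x)) = - (C (z / of_real (r k)) / of_real (r k))"
    proof -
      have "H p / (1 - q p * x) / z = - (H p / (q p - z / of_real (r k)) / of_real (r k))" for p
      proof -
        have "(1 - q p * x) * z = - ((q p - z / of_real (r k)) * of_real (r k))"
          using z0 r(1)[of k] by (simp add: x_def field_simps)
        then show ?thesis
          by (simp only: divide_divide_eq_left minus_divide_right)
      qed
      then have "(LINT p|M. H p / (1 - q p * x) / z) =
          (LINT p|M. - (H p / (q p - z / of_real (r k)) / of_real (r k)))"
        by (simp only:)
      then have "(LINT p|M. H p / (1 - q p * x)) / z = - (C (z / of_real (r k)) / of_real (r k))"
        unfolding integral_divide_zero Bochner_Integration.integral_minus C_def .
      then show ?thesis
        by simp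
    qed
    ultimately show ?thesis
      by (simp add: sums_iff)
  qed
  \<comment> \<open>The points \<open>r k * z\<close> and \<open>z / r k\<close> approach
    \<open>z\<close> from the two sides of the circle. As \<open>C\<close> is continuous at
    \<open>z\<close>, the two contributions cancel in the limit.\<close>
  have cont: "isCont C z"
    using C z(2) K(1) by (meson ComplI continuous_on_eq_continuous_at holomorphic_on_imp_continuous_on open_Compl)
  have r': "(\<lambda>k. complex_of_real (r k)) \<longlonglongrightarrow> of_real 1"
    by (intro tendsto_of_real r(3))
  have "(\<lambda>k. of_real (r k) * z) \<longlonglongrightarrow> of_real 1 * z"
    by (intro tendsto_mult r' tendsto_const)
  then have "(\<lambda>k. C (of_real (r k) * z)) \<longlonglongrightarrow> C z"
    by (intro isCont_tendsto_compose[OF cont]) simp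
  moreover have "(\<lambda>k. z / of_real (r k)) \<longlonglongrightarrow> z / of_real 1"
    by (intro tendsto_divide r' tendsto_const) simp
  then have "(\<lambda>k. C (z / of_real (r k))) \<longlonglongrightarrow> C z"
    by (intro isCont_tendsto_compose[OF cont]) simp
  ultimately have "(\<lambda>k. C (of_real (r k) * z) + - (C (z / of_real (r k)) / of_real (r k)))
      \<longlonglongrightarrow> C z + - (C z / of_real 1)"
    using r' by (intro tendsto_add tendsto_minus tendsto_divide) auto
  then show ?thesis
    unfolding inside outside by simp
qed

section \<open>Moments of the control\<close>

interpretation control: pair_sigma_finite lborel circle_measure ..

text \<open>An open interval is a countable union of compact ones, and their images are
  compact.\<close>

lemma cis_image_borel: "cis ` {a<..<b} \<in> sets borel"
proof -
  have "{a<..<b} = (\<Union>n. {a + 1 / Suc n..b - 1 / Suc n})"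
  proof (intro set_eqI iffI)
    fix x assume x: "x \<in> {a<..<b}"
    then obtain n where "inverse (real (Suc n)) < min (x - a) (b - x)"
      using reals_Archimedean[of "min (x - a) (b - x)"] by auto
    then show "x \<in> (\<Union>n. {a + 1 / Suc n..b - 1 / Suc n})"
      by (intro UN_I[of n]) (auto simp: inverse_eq_divide)
  next
    fix x assume "x \<in> (\<Union>n. {a + 1 / Suc n..b - 1 / Suc n})"
    then obtain n where "a + 1 / Suc n \<le> x" "x \<le> b - 1 / Suc n" by auto
    moreover have "1 / real (Suc n) > 0" by simp
    ultimately show "x \<in> {a<..<b}" by (simp only: greaterThanLessThan_iff) linarith
  qed
  then have "cis ` {a<..<b} = (\<Union>n. cis ` {a + 1 / Suc n..b - 1 / Suc n})"
    by (simp only: image_UN)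
  also have "\<dots> \<in> sets borel"
  proof (intro sets.countable_UN)
    have "compact (cis ` {c..d})" for c d
      by (intro compact_continuous_image continuous_intros compact_Icc)
    then show "range (\<lambda>n. cis ` {a + 1 / real (Suc n)..b - 1 / real (Suc n)}) \<subseteq> sets borel"
      by (auto intro: borel_compact)
  qed
  finally show ?thesis .
qed

text \<open>With \<open>q p = exp (- fst p) * snd p\<close> the integrand is
  \<open>v p * q p powi (- n)\<close>; it is kept factored so that Fubini separates time and
  circle.\<close>

definition control_moment :: "(real \<times> complex \<Rightarrow> complex) \<Rightarrow> int \<Rightarrow> complex" where
  "control_moment v n =
     (LINT p|(lborel \<Otimes>\<^sub>M circle_measure). v p * (of_real (exp (n * fst p)) * snd p powi (- n)))"

text \<open>The support condition holds at every point rather than almost everywhere, so estimates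
  on the time strip can be made pointwise.\<close>

definition control_density :: "real \<Rightarrow> (real \<times> complex \<Rightarrow> complex) \<Rightarrow> bool" where
  "control_density T v \<longleftrightarrow> sq_integrable (lborel \<Otimes>\<^sub>M circle_measure) v \<and>
     (\<forall>p. v p \<noteq> 0 \<longrightarrow> 0 \<le> fst p \<and> fst p \<le> T \<and> cmod (snd p) = 1)"

lemma control_density_integrable:
  assumes "control_density T v"
  shows "integrable (lborel \<Otimes>\<^sub>M circle_measure) v"
proof (rule Bochner_Integration.integrable_bound)
  have "emeasure (lborel \<Otimes>\<^sub>M circle_measure) ({0..T} \<times> UNIV) < \<infinity>"
    by (subst circle.emeasure_pair_measure_Times)
       (auto simp: circle.emeasure_eq_measure ennreal_mult_less_top emeasure_lborel_Icc_eq)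
  then show "integrable (lborel \<Otimes>\<^sub>M circle_measure)
      (\<lambda>p. indicator ({0..T} \<times> UNIV) p + (cmod (v p))\<^sup>2)"
    using assms by (intro Bochner_Integration.integrable_add integrable_real_indicator)
      (auto simp: control_density_def sq_integrable_def)
  \<comment> \<open>Square integrability implies integrability because \<open>v\<close> lives on a
    strip of finite measure, by the inequality \<open>x \<le> 1 + x\<^sup>2\<close>.\<close>
  have "cmod (v p) \<le> indicator ({0..T} \<times> UNIV) p + (cmod (v p))\<^sup>2" for p
  proof (cases "v p = 0")
    case False
    then have "p \<in> {0..T} \<times> UNIV"
      using assms by (cases p) (auto simp: control_density_def)
    moreover have "cmod (v p) \<le> 1 + (cmod (v p))\<^sup>2"
      using zero_le_power2[of "cmod (v p) - 1"] norm_ge_zero[of "v p"]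
      by (simp add: power2_diff del: norm_ge_zero)
    ultimately show ?thesis by simp
  qed simp
  then show "AE p in lborel \<Otimes>\<^sub>M circle_measure.
      cmod (v p) \<le> norm (indicator ({0..T} \<times> UNIV) p + (cmod (v p))\<^sup>2)"
    by (intro AE_I2) (simp add: abs_of_nonneg)
qed (use assms in \<open>simp add: control_density_def sq_integrable_def\<close>)

lemma control_density_slice:
  assumes "control_density T v"
  shows "AE s in lborel. sq_integrable circle_measure (\<lambda>z. v (s, z))"
proof -
  have [measurable]: "v \<in> borel_measurable (lborel \<Otimes>\<^sub>M circle_measure)"
    and int: "integrable (lborel \<Otimes>\<^sub>M circle_measure) (\<lambda>p. (cmod (v p))\<^sup>2)"
    using assms by (auto simp: control_density_def sq_integrable_def)
  have "(\<lambda>z. v (s, z)) \<in> borel_measurable circle_measure" for s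
    by measurable
  then show ?thesis
    using control.AE_integrable_fst'[OF int] by (simp add: sq_integrable_def)
qed

text \<open>A plain integral rather than a coefficient of a class: measurability in \<open>s\<close>
  then follows from the product structure. The two agree for almost every \<open>s\<close>, namely
  when the slice is square integrable.\<close>

definition slice_coeff :: "(real \<times> complex \<Rightarrow> complex) \<Rightarrow> int \<Rightarrow> real \<Rightarrow> complex" where
  "slice_coeff v n s = (LINT z|circle_measure. v (s, z) * z powi (- n))"

lemma slice_coeff_eq:
  assumes "control_density T v"
  shows "AE s in lborel. slice_coeff v n s = fourier_coeff (mk_L2 (\<lambda>z. v (s, z))) n"
  using control_density_slice[OF assms]
  by eventually_elim (simp add: slice_coeff_def fourier_coeff_mk_L2)

lemma slice_coeff_measurable [measurable]:
  assumes "v \<in> borel_measurable (lborel \<Otimes>\<^sub>M circle_measure)"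
  shows "slice_coeff v n \<in> borel_measurable borel"
proof -
  note [measurable] = assms
  have "(\<lambda>s. LINT z|circle_measure. v (s, z) * z powi (- n)) \<in> borel_measurable lborel"
    by measurable
  then show ?thesis
    by (simp add: slice_coeff_def[abs_def])
qed

lemma slice_coeff_outside:
  assumes "control_density T v" "s \<notin> {0..T}"
  shows "slice_coeff v n s = 0"
proof -
  have "v (s, z) = 0" for z
    using assms by (force simp: control_density_def)
  then show ?thesis by (simp add: slice_coeff_def)
qed

text \<open>Fubini; on the strip the exponential is bounded by
  \<open>exp (\<bar>n\<bar> * T)\<close>, so the moment exists for either sign of
  \<open>n\<close>.\<close>

lemma control_moment_slices:
  assumes v: "control_density T v"
  shows "integrable lborel (\<lambda>s. of_real (exp (n * s)) * slice_coeff v n s)"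
    and "control_moment v n = (LINT s|lborel. of_real (exp (n * s)) * slice_coeff v n s)"
proof -
  have [measurable]: "v \<in> borel_measurable (lborel \<Otimes>\<^sub>M circle_measure)"
    using v by (simp add: control_density_def sq_integrable_def)
  let ?f = "\<lambda>p. v p * (of_real (exp (real_of_int n * fst p)) * snd p powi (- n))"
  have int: "integrable (lborel \<Otimes>\<^sub>M circle_measure) ?f"
  proof (rule Bochner_Integration.integrable_bound)
    show "integrable (lborel \<Otimes>\<^sub>M circle_measure) (\<lambda>p. v p * of_real (exp (\<bar>n\<bar> * T)))"
      using control_density_integrable[OF v] by simp
    have "cmod (?f p) \<le> cmod (v p * of_real (exp (\<bar>n\<bar> * T)))" for p
    proof (cases "v p = 0")
      case False
      then have p: "0 \<le> fst p" "fst p \<le> T" "cmod (snd p) = 1"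
        using v unfolding control_density_def by blast+
      have "of_int n * fst p \<le> \<bar>of_int n\<bar> * fst p"
        using p(1) by (intro mult_right_mono) auto
      also have "\<dots> \<le> \<bar>of_int n\<bar> * T"
        using p(2) by (intro mult_left_mono) auto
      finally show ?thesis
        using p(3) by (simp add: norm_mult norm_power_int mult_left_mono)
    qed simp
    then show "AE p in lborel \<Otimes>\<^sub>M circle_measure.
        cmod (?f p) \<le> cmod (v p * of_real (exp (\<bar>n\<bar> * T)))"
      by simp
  qed measurable
  have slice: "(LINT z|circle_measure. ?f (s, z)) = of_real (exp (n * s)) * slice_coeff v n s" for s :: real
  proof -
    have "(LINT z|circle_measure. ?f (s, z)) =
        (LINT z|circle_measure. of_real (exp (n * s)) * (v (s, z) * z powi (- n)))"
      by (intro Bochner_Integration.integral_cong) (auto simp: mult_ac)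
    then show ?thesis
      by (simp only: slice_coeff_def integral_mult_right_zero)
  qed
  show "integrable lborel (\<lambda>s. of_real (exp (n * s)) * slice_coeff v n s)"
    using control.integrable_fst'[OF int] by (simp only: slice)
  show "control_moment v n = (LINT s|lborel. of_real (exp (n * s)) * slice_coeff v n s)"
    using control.integral_fst'[OF int] by (simp only: slice control_moment_def)
qed

lemma slice_coeff_bessel:
  assumes v: "control_density T v"
  defines "N \<equiv> \<lambda>s. LINT z|circle_measure. (cmod (v (s, z)))\<^sup>2"
  shows "integrable lborel N"
    and "finite F \<Longrightarrow> AE s in lborel. (\<Sum>n\<in>F. (cmod (slice_coeff v n s))\<^sup>2) \<le> N s"
proof -
  have "integrable (lborel \<Otimes>\<^sub>M circle_measure) (\<lambda>p. (cmod (v p))\<^sup>2)"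
    using v by (simp add: control_density_def sq_integrable_def)
  from control.integrable_fst'[OF this] show "integrable lborel N"
    by (simp add: N_def)
  assume F: "finite F"
  show "AE s in lborel. (\<Sum>n\<in>F. (cmod (slice_coeff v n s))\<^sup>2) \<le> N s"
    using control_density_slice[OF v]
  proof eventually_elim
    case (elim s)
    then have "slice_coeff v n s = fourier_coeff (mk_L2 (\<lambda>z. v (s, z))) n" for n
      by (simp add: slice_coeff_def fourier_coeff_mk_L2)
    moreover have "(norm (mk_L2 (\<lambda>z. v (s, z))))\<^sup>2 = N s"
      using elim by (simp add: norm_mk_L2 N_def integral_nonneg)
    ultimately show ?case
      using bessel_inequality[OF F, of "mk_L2 (\<lambda>z. v (s, z))"] by simp
  qed
qed

lemma slice_coeff_sq_integrable:
  assumes v: "control_density T v"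
  shows "integrable lborel (\<lambda>s. (cmod (slice_coeff v n s))\<^sup>2)"
proof (rule Bochner_Integration.integrable_bound[OF slice_coeff_bessel(1)[OF v]])
  have [measurable]: "v \<in> borel_measurable (lborel \<Otimes>\<^sub>M circle_measure)"
    using v by (simp add: control_density_def sq_integrable_def)
  show "(\<lambda>s. (cmod (slice_coeff v n s))\<^sup>2) \<in> borel_measurable lborel"
    by measurable
  show "AE s in lborel. norm ((cmod (slice_coeff v n s))\<^sup>2)
      \<le> norm (LINT z|circle_measure. (cmod (v (s, z)))\<^sup>2)"
    using slice_coeff_bessel(2)[OF v, of "{n}"] by (auto elim!: eventually_mono)
qed

section \<open>Weighted summability of the moments of negative index\<close>

lemma integral_exp_decay:
  fixes c T :: real
  assumes "c > 0" "T \<ge> 0"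
  shows "integrable lborel (\<lambda>s. indicator {0..T} s * exp (- (c * s)))"
    and "(LINT s|lborel. indicator {0..T} s * exp (- (c * s))) \<le> 1 / c"
proof -
  have "has_bochner_integral lborel (\<lambda>s. exp (- (c * s)) * indicator {0..T} s)
      (- exp (- (c * T)) / c - - exp (- (c * 0)) / c)"
    using assms
    by (intro has_bochner_integral_FTC_Icc_real) (auto intro!: derivative_eq_intros continuous_intros)
  then have hb: "has_bochner_integral lborel (\<lambda>s. indicator {0..T} s * exp (- (c * s)))
      ((1 - exp (- (c * T))) / c)"
    by (simp add: diff_divide_distrib mult.commute)
  then show "integrable lborel (\<lambda>s. indicator {0..T} s * exp (- (c * s)))"
    by (simp add: has_bochner_integral_iff)
  show "(LINT s|lborel. indicator {0..T} s * exp (- (c * s))) \<le> 1 / c"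
    using assms has_bochner_integral_integral_eq[OF hb] by (simp add: divide_right_mono)
qed

text \<open>Weighted AM-GM with weight \<open>\<lambda> = 2 p |m|\<close> in place of the Cauchy-Schwarz inequality.\<close>

lemma control_moment_bound:
  assumes v: "control_density T v" and T: "T \<ge> 0" and n: "n < 0"
  shows "\<bar>real_of_int n\<bar> * (cmod (control_moment v n))\<^sup>2 \<le>
    (LINT s|lborel. (cmod (slice_coeff v n s))\<^sup>2) / 2"
proof (cases "control_moment v n = 0")
  case True
  then show ?thesis by simp
next
  case False
  define p where "p = - real_of_int n"
  define m where "m = cmod (control_moment v n)"
  define B where "B = (LINT s|lborel. (cmod (slice_coeff v n s))\<^sup>2)"
  \<comment> \<open>This weight turns the exponential part of the estimate into
    \<open>m / 2\<close>, which the left side \<open>m\<close> absorbs; what remains is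
    \<open>p * m\<^sup>2 \<le> B / 2\<close>.\<close>
  define l where "l = 2 * p * m"
  have p: "p > 0" using n by (simp add: p_def)
  have m: "m > 0" using False by (simp add: m_def)
  have l: "l > 0" using p m by (simp add: l_def)
  have le: "cmod (of_real (exp (n * s)) * slice_coeff v n s) \<le>
      l / 2 * (indicator {0..T} s * exp (- (2 * p * s))) + (cmod (slice_coeff v n s))\<^sup>2 / (2 * l)" for s :: real
  proof (cases "s \<in> {0..T}")
    case True
    define x where "x = exp (- (p * s))"
    define y where "y = cmod (slice_coeff v n s)"
    have "0 \<le> (l * x - y)\<^sup>2 / (2 * l)" using l by simp
    also have "\<dots> = l / 2 * x\<^sup>2 + y\<^sup>2 / (2 * l) - x * y"
      using l by (simp add: power2_eq_square field_simps)
    finally have "x * y \<le> l / 2 * x\<^sup>2 + y\<^sup>2 / (2 * l)" by simp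
    moreover have "x\<^sup>2 = exp (- (2 * p * s))"
      by (simp add: x_def power2_eq_square flip: exp_add)
    ultimately show ?thesis
      using True by (simp add: x_def y_def p_def norm_mult)
  qed (simp add: slice_coeff_outside[OF v])
  have "m \<le> (LINT s|lborel. cmod (of_real (exp (n * s)) * slice_coeff v n s))"
    unfolding m_def control_moment_slices(2)[OF v] by (rule integral_norm_bound)
  also have "\<dots> \<le> (LINT s|lborel. l / 2 * (indicator {0..T} s * exp (- (2 * p * s))) +
      (cmod (slice_coeff v n s))\<^sup>2 / (2 * l))"
    using control_moment_slices(1)[OF v] integral_exp_decay(1)[of "2 * p" T] p T
      slice_coeff_sq_integrable[OF v] le
    by (intro integral_mono integrable_norm Bochner_Integration.integrable_add integrable_mult_right
        integrable_divide) auto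
  also have "\<dots> = l / 2 * (LINT s|lborel. indicator {0..T} s * exp (- (2 * p * s))) + B / (2 * l)"
    using integral_exp_decay(1)[of "2 * p" T] p T slice_coeff_sq_integrable[OF v]
    by (subst Bochner_Integration.integral_add) (auto simp: B_def)
  also have "\<dots> \<le> l / 2 * (1 / (2 * p)) + B / (2 * l)"
    using integral_exp_decay(2)[of "2 * p" T] p T l by (intro add_right_mono mult_left_mono) auto
  also have "\<dots> = m / 2 + B / (4 * p * m)"
    using p by (simp add: l_def)
  finally have "m / 2 \<le> B / (4 * p * m)" by linarith
  then have "m / 2 * (4 * p * m) \<le> B"
    using p m by (simp add: pos_le_divide_eq)
  then have "p * m\<^sup>2 \<le> B / 2"
    by (simp add: power2_eq_square mult_ac)
  then show ?thesis
    using n by (simp add: p_def m_def B_def)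
qed

text \<open>The individual bounds are added under the time integral and Bessel's inequality is
  applied in almost every slice, which gives a bound independent of the finite set
  \<open>F\<close>.\<close>

lemma control_moment_summable:
  assumes v: "control_density T v" and T: "T \<ge> 0"
  shows "(\<lambda>n. \<bar>real_of_int n\<bar> * (cmod (control_moment v n))\<^sup>2) summable_on {..<0}"
proof (rule nonneg_bdd_above_summable_on)
  define N where "N s = (LINT z|circle_measure. (cmod (v (s, z)))\<^sup>2)" for s
  show "bdd_above (sum (\<lambda>n. \<bar>real_of_int n\<bar> * (cmod (control_moment v n))\<^sup>2) `
      {F. F \<subseteq> {..<0} \<and> finite F})"
  proof (rule bdd_aboveI)
    fix y assume "y \<in> sum (\<lambda>n. \<bar>real_of_int n\<bar> * (cmod (control_moment v n))\<^sup>2) `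
      {F. F \<subseteq> {..<0} \<and> finite F}"
    then obtain F where F: "F \<subseteq> {..<0}" "finite F"
        "y = (\<Sum>n\<in>F. \<bar>real_of_int n\<bar> * (cmod (control_moment v n))\<^sup>2)" by blast
    have "y \<le> (\<Sum>n\<in>F. (LINT s|lborel. (cmod (slice_coeff v n s))\<^sup>2) / 2)"
      unfolding F(3) using F(1) by (intro sum_mono control_moment_bound[OF v T]) auto
    also have "\<dots> = (LINT s|lborel. (\<Sum>n\<in>F. (cmod (slice_coeff v n s))\<^sup>2)) / 2"
      by (simp add: sum_divide_distrib slice_coeff_sq_integrable[OF v])
    also have "\<dots> \<le> (LINT s|lborel. N s) / 2"
      unfolding N_def
      by (intro divide_right_mono integral_mono_AE slice_coeff_bessel[OF v]
          Bochner_Integration.integrable_sum slice_coeff_sq_integrable[OF v] F) auto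
    finally show "y \<le> (LINT s|lborel. N s) / 2" .
  qed
qed (intro mult_nonneg_nonneg abs_ge_zero zero_le_power2)

text \<open>For \<open>n \<ge> 0\<close> the projector keeps the coefficient and the semigroup
  multiplies it by \<open>exp (- (n * T)) * exp (n * s)\<close>. The free evolution carries the same
  factor \<open>exp (- (n * T))\<close>, which is nonzero and cancels.\<close>

lemma duhamel_moment:
  assumes v: "control_density T v" and T: "T \<ge> 0" and n: "n \<ge> 0"
    and u: "\<And>s z. s \<in> {0..T} \<Longrightarrow> v (s, z) = (if z \<in> \<omega> then u s z else 0)"
    and final: "H2_final_state \<omega> T f0 u 0"
  shows "fourier_coeff f0 n = - control_moment v n"
proof -
  have [measurable]: "v \<in> borel_measurable (lborel \<Otimes>\<^sub>M circle_measure)"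
    using v by (simp add: control_density_def sq_integrable_def)
  let ?g = "\<lambda>s. semigroup_absD (T - s) (riesz_projector (mk_L2 (\<lambda>z. if z \<in> \<omega> then u s z else 0)))"
  obtain I where I: "has_bochner_integral (restrict_space lborel {0..T}) ?g I"
      "0 = semigroup_absD T f0 + I"
    using final by (auto simp: H2_final_state_def)
  have hb: "has_bochner_integral (restrict_space lborel {0..T}) (\<lambda>s. fourier_coeff (?g s) n)
      (fourier_coeff I n)"
    by (rule has_bochner_integral_bounded_linear[OF bounded_linear_fourier_coeff I(1)])
  \<comment> \<open>Measurability of the integrand in time is inherited from the existence of the
    Bochner integral.\<close>
  then have meas: "(\<lambda>s. indicator {0..T} s *\<^sub>R fourier_coeff (?g s) n) \<in> borel_measurable lborel"
    using borel_measurable_restrict_space_iff[of "{0..T}" lborel "\<lambda>s. fourier_coeff (?g s) n"]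
      borel_measurable_has_bochner_integral[OF hb] by simp
  have "fourier_coeff I n = (LINT s|restrict_space lborel {0..T}. fourier_coeff (?g s) n)"
    using has_bochner_integral_integral_eq[OF hb] by simp
  also have "\<dots> = (LINT s|lborel. indicator {0..T} s *\<^sub>R fourier_coeff (?g s) n)"
    by (rule integral_restrict_space) simp
  also have "\<dots> = (LINT s|lborel. of_real (exp (- (n * T))) * (of_real (exp (n * s)) * slice_coeff v n s))"
  proof (rule integral_cong_AE[OF meas])
    show "AE s in lborel. indicator {0..T} s *\<^sub>R fourier_coeff (?g s) n =
        of_real (exp (- (n * T))) * (of_real (exp (n * s)) * slice_coeff v n s)"
      using slice_coeff_eq[OF v, of n]
    proof eventually_elim
      case (elim s)
      show ?case
      proof (cases "s \<in> {0..T}")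
        case True
        have "exp (- (\<bar>real_of_int n\<bar> * (T - s))) = exp (- (n * T)) * exp (n * s)"
          using n by (simp add: algebra_simps flip: exp_add)
        then show ?thesis
          using True n elim
          by (simp add: fourier_coeff_semigroup_absD fourier_coeff_riesz_projector u mult_ac)
      qed (simp add: slice_coeff_outside[OF v])
    qed
  qed measurable
  also have "\<dots> = of_real (exp (- (n * T))) * control_moment v n"
    by (simp add: control_moment_slices(2)[OF v])
  finally have "fourier_coeff I n = of_real (exp (- (n * T))) * control_moment v n" .
  moreover have "fourier_coeff (semigroup_absD T f0) n = fourier_coeff f0 n * of_real (exp (- (n * T)))"
    using n T by (simp add: fourier_coeff_semigroup_absD)
  moreover have "fourier_coeff (semigroup_absD T f0) n + fourier_coeff I n = 0"
    using linear_add[OF bounded_linear.linear[OF bounded_linear_fourier_coeff], of "semigroup_absD T f0" I n]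
      linear_0[OF bounded_linear.linear[OF bounded_linear_fourier_coeff], of n] I(2) by simp
  ultimately have "of_real (exp (- (n * T))) * (fourier_coeff f0 n + control_moment v n) = 0"
    by (simp add: algebra_simps)
  then show ?thesis
    by (simp add: add_eq_0_iff2)
qed

section \<open>The support of the extension\<close>

lemma L2_support_subset:
  assumes "sq_integrable circle_measure \<gamma>" "open U" "AE z in circle_measure. z \<in> U \<longrightarrow> \<gamma> z = 0"
  shows "L2_support (mk_L2 \<gamma>) \<subseteq> - U"
  using assms by transfer auto

text \<open>The Abel means converge to \<open>g1 + g2\<close> in norm, so a subsequence converges
  almost everywhere to a representative; on \<open>U\<close> the pointwise limit is 0.\<close>

lemma vanishes_if_abel_means_vanish:
  fixes a :: "int \<Rightarrow> complex"
  assumes g1: "((\<lambda>n. fourier_term n (a n)) has_sum g1) {0..}"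
    and g2: "((\<lambda>n. fourier_term n (a n)) has_sum g2) {..<0}"
    and sq: "(\<lambda>n. (cmod (a n))\<^sup>2) summable_on UNIV"
    and r: "\<And>k. 0 < r k" "\<And>k. r k < 1" "r \<longlonglongrightarrow> 1"
    and U: "open U" and van: "\<And>z. cmod z = 1 \<Longrightarrow> z \<in> U \<Longrightarrow>
      (\<lambda>k. (\<Sum>n. a (int n) * of_real (r k) ^ n * z powi int n) +
      (\<Sum>n. a (- 1 - int n) * of_real (r k) ^ n * z powi (- 1 - int n))) \<longlonglongrightarrow> 0"
  shows "L2_support (g1 + g2) \<subseteq> - U"
proof -
  \<comment> \<open>Enumerates the negative frequencies starting at -1, so frequency
    \<open>m < 0\<close> carries the weight \<open>r ^ (\<bar>m\<bar> - 1)\<close>.\<close>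
  let ?\<tau> = "\<lambda>n. - 1 - int n"
  have img: "range int = {0..}" "range ?\<tau> = {..<0}"
  proof -
    show "range int = {0..}"
      by (auto simp: image_iff intro: nonneg_int_cases)
    show "range ?\<tau> = {..<0}"
    proof (intro equalityI subsetI)
      show "x \<in> range ?\<tau>" if "x \<in> {..<0}" for x
        using that by (intro image_eqI[of _ _ "nat (- 1 - x)"]) auto
    qed auto
  qed
  have inj: "inj int" "inj ?\<tau>" by (auto simp: inj_def)
  define p where "p k z = (\<Sum>n. a (int n) * of_real (r k) ^ n * z powi int n)" for k z
  define p' where "p' k z = (\<Sum>n. a (?\<tau> n) * of_real (r k) ^ n * z powi ?\<tau> n)" for k z
  have sums: "(\<lambda>n. fourier_term (int n) (a (int n))) sums g1"
    "(\<lambda>n. fourier_term (?\<tau> n) (a (?\<tau> n))) sums g2"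
    using g1 g2 unfolding img[symmetric] has_sum_reindex[OF inj(1)] has_sum_reindex[OF inj(2)]
    by (auto dest: has_sum_imp_sums simp: o_def)
  have summ: "summable (\<lambda>n. (cmod (a (\<sigma> n)))\<^sup>2)" if "inj \<sigma>" for \<sigma> :: "nat \<Rightarrow> int"
  proof -
    have "(\<lambda>n. (cmod (a n))\<^sup>2) summable_on range \<sigma>"
      using sq by (rule summable_on_subset_banach) simp
    then show ?thesis
      unfolding summable_on_reindex[OF that] by (auto dest: summable_on_imp_summable simp: o_def)
  qed
  have r': "0 \<le> r k" for k using r(1)[of k] by simp
  have bdd: "cmod (a n) \<le> sqrt (\<Sum>\<^sub>\<infinity>n. (cmod (a n))\<^sup>2)" for n
  proof (rule real_le_rsqrt)
    have "sum (\<lambda>n. (cmod (a n))\<^sup>2) {n} \<le> (\<Sum>\<^sub>\<infinity>n. (cmod (a n))\<^sup>2)"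
      by (rule finite_sum_le_infsum[OF sq]) auto
    then show "(cmod (a n))\<^sup>2 \<le> (\<Sum>\<^sub>\<infinity>n. (cmod (a n))\<^sup>2)" by simp
  qed
  have p: "sq_integrable circle_measure (p k)" and p': "sq_integrable circle_measure (p' k)" for k
    unfolding p_def p'_def by (rule sq_integrable_abel_mean, rule bdd, rule r', rule r(2))+
  have "(\<lambda>k. mk_L2 (p k)) \<longlonglongrightarrow> g1" "(\<lambda>k. mk_L2 (p' k)) \<longlonglongrightarrow> g2"
    unfolding p_def p'_def
    by (rule abel_mean_tendsto[OF inj(1) summ[OF inj(1)] sums(1) r' r(2,3)])
       (rule abel_mean_tendsto[OF inj(2) summ[OF inj(2)] sums(2) r' r(2,3)])
  then have "(\<lambda>k. mk_L2 (p k) + mk_L2 (p' k)) \<longlonglongrightarrow> g1 + g2"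
    by (rule tendsto_add)
  then have lim: "(\<lambda>k. mk_L2 (\<lambda>z. p k z + p' k z)) \<longlonglongrightarrow> g1 + g2"
    by (simp add: mk_L2_add p p')
  obtain \<gamma> where \<gamma>: "sq_integrable circle_measure \<gamma>" "g1 + g2 = mk_L2 \<gamma>"
    by (rule mk_L2_cases)
  \<comment> \<open>The squared error: convergence in \<open>circle_L2\<close> becomes convergence
    of \<open>e\<close> in mean, which provides the subsequence.\<close>
  define e where "e k z = (cmod (p k z + p' k z - \<gamma> z))\<^sup>2" for k z
  have diff: "sq_integrable circle_measure (\<lambda>z. p k z + p' k z - \<gamma> z)" for k
    by (intro sq_integrable_diff sq_integrable_add p p' \<gamma>)
  have "(\<lambda>k. (norm (mk_L2 (\<lambda>z. p k z + p' k z) - mk_L2 \<gamma>))\<^sup>2) \<longlonglongrightarrow> 0\<^sup>2"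
    using lim unfolding \<gamma>(2) by (intro tendsto_power tendsto_norm_zero LIM_zero)
  moreover have "(norm (mk_L2 (\<lambda>z. p k z + p' k z) - mk_L2 \<gamma>))\<^sup>2 = (LINT z|circle_measure. norm (e k z))" for k
    unfolding mk_L2_diff[OF sq_integrable_add[OF p p'] \<gamma>(1), symmetric] norm_mk_L2[OF diff]
    by (simp add: e_def integral_nonneg)
  ultimately have "(\<lambda>k. LINT z|circle_measure. norm (e k z)) \<longlonglongrightarrow> 0"
    by simp
  moreover have "integrable circle_measure (e k)" for k
    using diff[of k] by (simp add: e_def[abs_def] sq_integrable_def)
  ultimately obtain \<rho> where \<rho>: "strict_mono \<rho>" "AE z in circle_measure. (\<lambda>k. e (\<rho> k) z) \<longlonglongrightarrow> 0"
    using tendsto_L1_AE_subseq[of circle_measure e] by blast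
  have "AE z in circle_measure. z \<in> U \<longrightarrow> \<gamma> z = 0"
    using \<rho>(2) AE_circle_norm
  proof (eventually_elim, intro impI)
    fix z assume z: "(\<lambda>k. e (\<rho> k) z) \<longlonglongrightarrow> 0" "cmod z = 1" "z \<in> U"
    have "(\<lambda>k. p k z + p' k z) \<longlonglongrightarrow> 0"
      using van[OF z(2,3)] by (simp add: p_def p'_def)
    then have "(\<lambda>k. p (\<rho> k) z + p' (\<rho> k) z) \<longlonglongrightarrow> 0"
      using LIMSEQ_subseq_LIMSEQ[OF _ \<rho>(1)] by (fastforce simp: o_def)
    then have "(\<lambda>k. e (\<rho> k) z) \<longlonglongrightarrow> (cmod (0 - \<gamma> z))\<^sup>2"
      unfolding e_def by (intro tendsto_intros)
    with z(1) have "(cmod (0 - \<gamma> z))\<^sup>2 = 0"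
      using LIMSEQ_unique by blast
    then show "\<gamma> z = 0" by simp
  qed
  then show ?thesis
    unfolding \<gamma>(2) using \<gamma>(1) U by (intro L2_support_subset)
qed

section \<open>Construction of the extension and geometry of the set \<open>K\<close>\<close>

theorem theorem1p5:
  fixes \<omega> :: "complex set" and T :: real and f0 :: circle_L2
  assumes "open_strict_interval \<omega>"
    and "T > 0"
    and "f0 \<in> null_controllable_H2 \<omega> T"
  shows "\<exists>g :: circle_L2.
           L2_support g \<subseteq> closure \<omega> \<and>
           (\<lambda>n::int. \<bar>real_of_int n\<bar> * (cmod (fourier_coeff g n))\<^sup>2) summable_on {..<0} \<and>
           f0 = riesz_projector g"
proof -
  obtain \<alpha> \<beta> where \<omega>: "\<omega> = cis ` {\<alpha><..<\<beta>}"
    using assms(1) by (auto simp: open_strict_interval_def)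
  have \<omega>_sets: "\<omega> \<in> sets borel"
    unfolding \<omega> by (rule cis_image_borel)
  have circ: "closure \<omega> \<subseteq> sphere 0 1"
    unfolding \<omega> by (intro closure_minimal) auto
  then have \<omega>_circ: "\<omega> \<subseteq> sphere 0 1"
    using closure_subset by blast
  obtain u where u: "L2_control \<omega> T u" "H2_final_state \<omega> T f0 u 0" and "f0 \<in> hardy_H2"
    using assms(3) by (auto simp: null_controllable_H2_def)
  then obtain f1 where f1: "f0 = riesz_projector f1"
    by (auto simp: hardy_H2_def)
  let ?M = "lborel \<Otimes>\<^sub>M circle_measure"
  define v where "v p = indicator ({0..T} \<times> \<omega>) p *\<^sub>R (case p of (s, z) \<Rightarrow> u s z)" for p
  have S: "{0..T} \<times> \<omega> \<inter> space ?M \<in> sets ?M"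
    using \<omega>_sets by (auto simp: space_pair_measure)
  have v_supp: "fst p \<in> {0..T} \<and> snd p \<in> \<omega>" if "v p \<noteq> 0" for p
    using that by (cases p) (auto simp: v_def indicator_def split: if_splits)
  have v: "control_density T v"
    unfolding control_density_def sq_integrable_def
  proof (intro conjI allI impI)
    have *: "(\<lambda>(s, z). u s z) \<in> borel_measurable (restrict_space ?M ({0..T} \<times> \<omega>))"
      "integrable (restrict_space ?M ({0..T} \<times> \<omega>)) (\<lambda>p. (cmod (case p of (s, z) \<Rightarrow> u s z))\<^sup>2)"
      using u(1) by (auto simp: L2_control_def sq_integrable_def)
    show "v \<in> borel_measurable ?M"
      using *(1) unfolding borel_measurable_restrict_space_iff[OF S] v_def[abs_def] .
    have "(cmod (v p))\<^sup>2 = indicator ({0..T} \<times> \<omega>) p *\<^sub>R (cmod (case p of (s, z) \<Rightarrow> u s z))\<^sup>2" for p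
      by (simp add: v_def indicator_def)
    then show "integrable ?M (\<lambda>p. (cmod (v p))\<^sup>2)"
      using *(2) unfolding integrable_restrict_space[OF S] by (simp only:)
  qed (use v_supp \<omega>_circ in force)+
  define q where "q p = of_real (exp (- fst p)) * snd p" for p :: "real \<times> complex"
  \<comment> \<open>The extra factor \<open>q\<close> shifts the exponent so that
    \<open>H p * q p powi (- n - 1)\<close> is minus the integrand of the moment, as the Cauchy
    transform requires.\<close>
  define H where "H p = - (v p * q p)" for p
  define a where "a n = - control_moment v n" for n
  have a_nonneg: "a n = fourier_coeff f0 n" if "n \<ge> 0" for n
    using duhamel_moment[OF v _ that _ u(2)] assms(2) by (simp add: a_def v_def indicator_def)
  have [measurable]: "q \<in> borel_measurable ?M"
    unfolding q_def by measurable
  have q_norm: "cmod (q p) = exp (- fst p)" if "v p \<noteq> 0" for p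
    using v_supp[OF that] \<omega>_circ by (auto simp: q_def norm_mult)
  have H: "integrable ?M H"
  proof (rule Bochner_Integration.integrable_bound[OF control_density_integrable[OF v]])
    have "cmod (H p) \<le> cmod (v p)" for p
    proof (cases "v p = 0")
      case False
      then show ?thesis
        using v_supp[OF False] q_norm[OF False] by (simp add: H_def norm_mult mult_left_le)
    qed (simp add: H_def)
    then show "AE p in ?M. cmod (H p) \<le> cmod (v p)" by simp
    show "H \<in> borel_measurable ?M"
      using borel_measurable_integrable[OF control_density_integrable[OF v]] unfolding H_def by measurable
  qed
  have a_eq: "a n = (LINT p|?M. H p * q p powi (- n - 1))" for n
  proof -
    have "- (v p * (of_real (exp (n * fst p)) * snd p powi (- n))) = H p * q p powi (- n - 1)"
      for p :: "real \<times> complex"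
    proof (cases "v p = 0")
      case False
      then have "q p \<noteq> 0"
        using q_norm[OF False] by auto
      then have "q p * q p powi (- n - 1) = q p powi (- n)"
        by (simp add: power_int_diff)
      moreover have "q p powi (- n) = of_real (exp (n * fst p)) * snd p powi (- n)"
        using exp_power_int[of "- fst p" "- n"]
        by (simp add: q_def power_int_mult_distrib mult.commute flip: of_real_power_int)
      ultimately show ?thesis
        by (simp add: H_def mult.assoc)
    qed (simp add: H_def)
    then show ?thesis
      unfolding a_def control_moment_def Bochner_Integration.integral_minus[symmetric] by (simp only:)
  qed
  have wsum: "(\<lambda>n. \<bar>real_of_int n\<bar> * (cmod (a n))\<^sup>2) summable_on {..<0}"
    using control_moment_summable[OF v] assms(2) by (simp add: a_def)
  \<comment> \<open>For negative indices the weight is at least 1; for the others the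
    \<open>a n\<close> are coefficients of \<open>f0\<close>, and Bessel's inequality
    applies.\<close>
  have sq_neg: "(\<lambda>n. (cmod (a n))\<^sup>2) summable_on {..<0}"
  proof (rule summable_on_comparison_test[OF wsum])
    fix n :: int assume "n \<in> {..<0}"
    then have "1 \<le> \<bar>real_of_int n\<bar>" by simp
    then show "(cmod (a n))\<^sup>2 \<le> \<bar>real_of_int n\<bar> * (cmod (a n))\<^sup>2"
      using mult_right_mono[of 1 "\<bar>real_of_int n\<bar>" "(cmod (a n))\<^sup>2"] by simp
  qed simp
  have sq_pos: "(\<lambda>n. (cmod (a n))\<^sup>2) summable_on {0..}"
    using bessel_summable[of f0 "{0..}"] by (rule summable_on_cong[THEN iffD1, rotated]) (simp add: a_nonneg)
  have "(\<lambda>n. (cmod (a n))\<^sup>2) summable_on {0..} \<union> {..<0}"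
    by (intro summable_on_Un_disjoint sq_pos sq_neg) auto
  moreover have "{0..} \<union> {..<0::int} = UNIV" by auto
  ultimately have sq: "(\<lambda>n. (cmod (a n))\<^sup>2) summable_on UNIV" by (simp only:)
  have f0_sum: "((\<lambda>n. fourier_term n (a n)) has_sum f0) {0..}"
    using riesz_projector_has_sum[of f1] unfolding f1[symmetric]
    by (rule has_sum_cong[THEN iffD1, rotated])
       (simp add: a_nonneg f1 fourier_coeff_riesz_projector)
  obtain g2 where g2: "((\<lambda>n. fourier_term n (a n)) has_sum g2) {..<0}"
    using summable_on_fourier_term[OF sq_neg] by (auto simp: summable_on_def)
  have g_coeff: "fourier_coeff (f0 + g2) n = a n" for n
    using linear_add[OF bounded_linear.linear[OF bounded_linear_fourier_coeff], of f0 g2 n]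
      fourier_coeff_has_sum[OF f0_sum, of n] fourier_coeff_has_sum[OF g2, of n] by auto
  \<comment> \<open>The radial segments over the closed arc that \<open>q\<close> sweeps during the
    control time. They meet the unit circle only at \<open>s = 0\<close>, hence only in
    \<open>closure \<omega>\<close>.\<close>
  define K where "K = (\<lambda>(s, z). of_real (exp (- s)) * z) ` ({0..T} \<times> closure \<omega>)"
  have "compact (closure \<omega>)"
    using circ by (simp add: bounded_subset[OF bounded_sphere] compact_eq_bounded_closed)
  then have "compact K"
    unfolding K_def
    by (intro compact_continuous_image compact_Times) (auto simp: case_prod_unfold intro!: continuous_intros)
  then have K_closed: "closed K" by (rule compact_imp_closed)
  have K_circ: "z \<in> closure \<omega>" if "z \<in> K" "cmod z = 1" for z
    using that circ by (force simp: K_def norm_mult)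
  have "L2_support (f0 + g2) \<subseteq> - (- closure \<omega>)"
  proof (rule vanishes_if_abel_means_vanish[OF f0_sum g2 sq])
    \<comment> \<open>The shift by 2 makes \<open>r 0\<close> positive.\<close>
    define r where "r k = 1 - 1 / real (k + 2)" for k
    show r: "0 < r k" "r k < 1" "r \<longlonglongrightarrow> 1" for k
    proof -
      show "0 < r k" "r k < 1" by (simp_all add: r_def)
      have "(\<lambda>k. 1 - 1 / real (k + 2)) \<longlonglongrightarrow> 1 - 0"
        by (intro tendsto_diff tendsto_const LIMSEQ_ignore_initial_segment lim_1_over_n)
      then show "r \<longlonglongrightarrow> 1" by (simp add: r_def[abs_def])
    qed
    fix z assume z: "cmod z = 1" "z \<in> - closure \<omega>"
    show "(\<lambda>k. (\<Sum>n. a (int n) * of_real (r k) ^ n * z powi int n) +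
      (\<Sum>n. a (- 1 - int n) * of_real (r k) ^ n * z powi (- 1 - int n))) \<longlonglongrightarrow> 0"
    proof (rule cauchy_transform_boundary[OF H \<open>q \<in> borel_measurable ?M\<close> K_closed _ _ _ _ a_eq _ z(1) _ r])
      show "K \<subseteq> cball 0 1" "0 \<notin> K"
        using circ by (force simp: K_def norm_mult)+
      show "q p \<in> K" if "H p \<noteq> 0" for p
      proof -
        have "v p \<noteq> 0" using that by (auto simp: H_def)
        then have "(fst p, snd p) \<in> {0..T} \<times> closure \<omega>"
          using v_supp[of p] closure_subset by blast
        then show ?thesis
          unfolding K_def q_def by (rule image_eqI[rotated]) (simp add: case_prod_beta)
      qed
      show "of_real t * w \<notin> K" if w: "w \<notin> K" "cmod w \<le> 1" and t: "0 \<le> t" "t \<le> 1" for w t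
      proof
        assume "of_real t * w \<in> K"
        then obtain s \<zeta> where s: "s \<in> {0..T}" "\<zeta> \<in> closure \<omega>" "of_real t * w = of_real (exp (- s)) * \<zeta>"
          by (auto simp: K_def)
        have \<zeta>: "cmod \<zeta> = 1" using circ s(2) by auto
        have norm: "t * cmod w = exp (- s)"
          using arg_cong[OF s(3), of cmod] t(1) \<zeta> by (simp add: norm_mult)
        then have t0: "t > 0"
          using t(1) by (cases "t = 0") auto
        \<comment> \<open>Undoing the contraction by \<open>t\<close> shifts time by
          \<open>ln t \<le> 0\<close>, so \<open>s' \<le> T\<close>; and
          \<open>cmod w \<le> 1\<close> forces \<open>s' \<ge> 0\<close>. Hence \<open>w\<close>
          would already lie in \<open>K\<close>.\<close>
        define s' where "s' = s + ln t"
        have exp_s': "exp (- s') = exp (- s) / t"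
        proof -
          have "- s' = - s - ln t" by (simp add: s'_def)
          then show ?thesis using t0 by (simp only: exp_diff exp_ln)
        qed
        have "exp (- s') = cmod w"
          using norm t0 by (simp add: exp_s' field_simps)
        then have "s' \<ge> 0"
          using w(2) by (metis exp_le_one_iff neg_le_0_iff_le)
        moreover have "s' \<le> T"
          using s(1) ln_le_zero_iff[OF t0] t(2) by (simp add: s'_def)
        moreover have "w = of_real (exp (- s')) * \<zeta>"
          using s(3) t0 by (simp add: exp_s' field_simps)
        ultimately have "w \<in> K"
          unfolding K_def using s(2) by (intro image_eqI[of _ _ "(s', \<zeta>)"]) auto
        with w(1) show False ..
      qed
      show "summable (\<lambda>n. a (int n) * w ^ n)" if w: "cmod w < 1" for w
      proof (rule summable_comparison_test')
        show "summable (\<lambda>n. norm f0 * cmod w ^ n)"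
          using w by (intro summable_mult summable_geometric) simp
        \<comment> \<open>Bessel's inequality for a single frequency bounds the coefficients, which
          suffices inside the unit disk.\<close>
        have "cmod (fourier_coeff f0 n) \<le> norm f0" for n
          using bessel_inequality[of "{n}" f0] by (auto intro: power2_le_imp_le)
        then show "norm (a (int n) * w ^ n) \<le> norm f0 * cmod w ^ n" if "n \<ge> 0" for n
          by (simp add: norm_mult norm_power a_nonneg mult_right_mono)
      qed
      show "z \<notin> K" using K_circ z by auto
    qed
  qed auto
  then have "L2_support (f0 + g2) \<subseteq> closure \<omega>" by simp
  moreover have "(\<lambda>n::int. \<bar>real_of_int n\<bar> * (cmod (fourier_coeff (f0 + g2) n))\<^sup>2) summable_on {..<0}"
    using wsum by (simp only: g_coeff)
  moreover have "f0 = riesz_projector (f0 + g2)"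
    \<comment> \<open>Both sides are sums of the same series over \<open>n \<ge> 0\<close>.\<close>
    using riesz_projector_has_sum[of "f0 + g2"] f0_sum unfolding g_coeff by (rule has_sum_unique[symmetric])
  ultimately show ?thesis by blast
qed

end
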